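(* Let $G$ be a connected graph, let $\mathcal Y$ be a principal collection of vertex sets of $G$ and let $\mathcal K$ be an admissible function for $\mathcal Y$. Let $T=\{\{X,\mathcal K(X)\},\{X,K\}\mid X\in\mathcal Y,\ K\in\mathcal K(X)\}$, and for $X\in\mathcal Y$ let $\sigma_X$ be the star consisting of $(X,\mathcal K(X))$ and all $(K,X)$ with $K\in\mathcal K(X)$. Then: (i) For every two distinct $X,Y\in\mathcal Y$, after possibly swapping $X$ and $Y$, either $(\mathcal K(X),X)\le(Y,\mathcal K(Y))$ or $(X,\mathcal K(X))\le(X,C_X(Y))\le(Y,\mathcal K(Y))$. The collection of all separations $(\mathcal K(X),X)$ with $X\in\mathcal Y$ and $\mathcal K(X)\subsetneq\check{\mathcal C}_X$ forms a consistent partial orientation of $T$. (ii) $T$ is nested. It is a regular tree set if $\emptyset\subsetneq\mathcal K(X)\subsetneq\mathcal C_X$ holds for all $X\in\mathcal Y$. (iii) Every star $\sigma_X$ with $X\in\mathcal Y$ is a splitting star of $\vec T$ (the set of orientations of separations in $T$). Moreover, if all vertex sets in $\mathcal Y$ are finite, then: (iv) If $\tau$ is an ultrafilter tangle of $G$ with $X_\tau\in\mathcal Y$ and $\mathcal K(X_\tau)\in U(\tau,X_\tau)$, then $\tau\cap\vec T$ equals the down-closure of $\sigma_{X_\tau}$ in $\vec T$. (v) If $\mathrm{crit}(G)\subseteq\mathcal Y$ and $\check{\mathcal C}_X\setminus\mathcal K(X)$ is finite for all $X\in\mathrm{crit}(G)$, then for every two inequivalent ultrafilter tangles $\tau_1,\tau_2$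 of $G$ the set $T$ contains a separation distinguishing them that has an orientation in $\sigma_{X_{\tau_1}}$ (and one that has an orientation in $\sigma_{X_{\tau_2}}$), and for every end $\omega$ and every ultrafilter tangle $\tau$ of $G$ the set $T$ contains a separation with an orientation in $\sigma_{X_\tau}$ that distinguishes the end tangle $\tau_\omega$ from $\tau$.
   Context: $G=(V,E)$. A separation of $G$ is $\{A,B\}$ with $A\cup B=V$ and no edge between $A\setminus B$ and $B\setminus A$; orientations $(A,B),(B,A)$ (mutually inverse, $\overleftarrow s$ denotes the inverse of $\vec s$), ordered by $(A,B)\le(C,D)$ iff $A\subseteq C$, $B\supseteq D$. For a vertex set $X$, $\mathcal C_X$ is the set of components of $G-X$, $\check{\mathcal C}_X$ the set of $C\in\mathcal C_X$ with $N(C)=X$; for $\mathcal C\subseteq\mathcal C_X$, $(X,\mathcal C):=(V\setminus V[\mathcal C],X\cup V[\mathcal C])$ where $V[\mathcal C]$ is the union of the vertex sets of members of $\mathcal C$, $(\mathcal C,X)$ is its inverse, $\{X,\mathcal C\}$ the separation; for a single component $K$ write $(X,K),(K,X),\{X,K\}$. Principal/admissible: $X$ is $\mathcal Y$-principal if for every $Y\in\mathcal Y$ it meets at most one component of $G-Y$; $\mathcal Y$ is principal if all members are $\mathcal Y$-principal. If $Y$ meets exactly one component of $G-X$, it is denoted $C_X(Y)$. A function $\mathcal K$ with $\mathcal K(X)\subseteq\check{\mathcal C}_X$ for $X\in\mathcal Y$ is admissible if for all $X,Y\in\mathcal Y$ incomparable as sets, $C_X(Y)\notin\mathcal K(X)$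 or $C_Y(X)\notin\mathcal K(Y)$. Separation systems: a set $T$ of separations is nested if any two have comparable orientations; an orientation $\vec r$ is degenerate if $\vec r=\overleftarrow r$, trivial if there is $s\in T$, $s\ne r$, with $\vec r<\vec s$ and $\vec r<\overleftarrow s$, small if $\vec r\le\overleftarrow r$. A tree set is a nested set with no degenerate or trivial orientations; regular if no orientation is small. A (partial) orientation of $T$ contains exactly one orientation of each separation of $T$ (of a subset of $T$); it is consistent if there are no distinct $r,s$ with orientations $\vec r<\vec s$ such that $\overleftarrow r$ and $\vec s$ both belong to it. A star is a set $\sigma$ with $\vec r\le\overleftarrow s$ for all distinct $\vec r,\vec s\in\sigma$. A splitting star of $\vec T$ is a star $\sigma\subseteq\vec T$ that is the set of maximal elements of some consistent orientation $O$ of $T$ with $O=\{\vec r\in\vec T:\exists\vec s\in\sigma,\ \vec r\le\vec s\}$ (the down-closure of $\sigma$ in $\vec T$). Tangles: an $\aleph_0$-tangle is a consistent orientation of the set of finite-order separations of $G$ containing no finite star whose interior $\bigcap B$ (over its members $(A,B)$) is finite. $U(\tau,X)=\{\mathcal C\subseteq\mathcal C_X:(X,\mathcal C)\in\tau\}$ for finite $X$; $\tau$ is an ultrafilter tangle if some $U(\tau,X)$ is free, and $X_\tau$ is the $\subseteq$-least such $X$. Ultrafilter tangles $\tau_1,\tau_2$ are inequivalent if $X_{\tau_1}\ne X_{\tau_2}$. An end $\omega$ (equivalence class of rays having tails in the same component of $G-X$ for every finite $X$) has end tangle $\tau_\omega=\{(X,\mathcal C):C(X,\omega)\in\mathcal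 C\}$, $C(X,\omega)$ the component of $G-X$ containing tails of its rays. A finite $X$ is critical if $\check{\mathcal C}_X$ is infinite; $\mathrm{crit}(G)$ is the set of critical vertex sets. A separation $\{A,B\}$ distinguishes two tangles if one contains $(A,B)$ and the other $(B,A)$.
   Formalization: In (iii), σ_X is shown to be a star for all X, but a splitting star only if X=V or K(X) is a proper subset of C_X with at least two elements; otherwise (iii) fails, e.g. if K(X)={K} then σ_X contains both (X,K) and its inverse (K,X). *)

theory Defs
  imports Main
begin

section \<open>Graphs\<close>

text \<open>Graphs are simple and undirected, of arbitrary cardinality; edges are two-element sets of vertices.\<close>

record 'a graph =
  verts :: "'a set"
  edges :: "'a set set"

definition simple_graph :: "'a graph \<Rightarrow> bool" where
  "simple_graph G \<longleftrightarrow>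
     (\<forall>e\<in>edges G. \<exists>u\<in>verts G. \<exists>v\<in>verts G. u \<noteq> v \<and> e = {u, v})"

definition adj :: "'a graph \<Rightarrow> 'a \<Rightarrow> 'a \<Rightarrow> bool" where
  "adj G u v \<longleftrightarrow> {u, v} \<in> edges G"

definition connected_graph :: "'a graph \<Rightarrow> bool" where
  "connected_graph G \<longleftrightarrow>
     verts G \<noteq> {} \<and> (\<forall>u\<in>verts G. \<forall>v\<in>verts G. (adj G)\<^sup>*\<^sup>* u v)"

definition del_verts :: "'a graph \<Rightarrow> 'a set \<Rightarrow> 'a graph" where
  "del_verts G X = \<lparr>verts = verts G - X, edges = {e \<in> edges G. e \<inter> X = {}}\<rparr>"

text \<open>Components are represented by their vertex sets.\<close>

definition components :: "'a graph \<Rightarrow> 'a set set" where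
  "components G = {{v \<in> verts G. (adj G)\<^sup>*\<^sup>* u v} | u. u \<in> verts G}"

definition comps :: "'a graph \<Rightarrow> 'a set \<Rightarrow> 'a set set" where
  "comps G X = components (del_verts G X)"

definition nbhd :: "'a graph \<Rightarrow> 'a set \<Rightarrow> 'a set" where
  "nbhd G C = {v \<in> verts G - C. \<exists>u\<in>C. adj G u v}"

text \<open>The set written \<open>\<C>\<close> with a check accent and index \<open>X\<close>.\<close>

definition full_comps :: "'a graph \<Rightarrow> 'a set \<Rightarrow> 'a set set" where
  "full_comps G X = {C \<in> comps G X. nbhd G C = X}"

definition crit :: "'a graph \<Rightarrow> 'a set set" where
  "crit G = {X. X \<subseteq> verts G \<and> finite X \<and> infinite (full_comps G X)}"


section \<open>Separation systems\<close>

text \<open>An unoriented separation is the unordered pair \<open>{A, B}\<close>, an oriented one the pair \<open>(A, B)\<close>.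
  The notions that do not mention a graph make sense for arbitrary sets of unordered pairs.\<close>

type_synonym 'a sep = "'a set set"
type_synonym 'a osep = "'a set \<times> 'a set"

definition separations :: "'a graph \<Rightarrow> 'a sep set" where
  "separations G = {{A, B} | A B. A \<union> B = verts G \<and>
     (\<forall>a \<in> A - B. \<forall>b \<in> B - A. \<not> adj G a b)}"

definition underlying :: "'a osep \<Rightarrow> 'a sep" where
  "underlying r = {fst r, snd r}"

abbreviation inv_sep :: "'a osep \<Rightarrow> 'a osep" where
  "inv_sep \<equiv> prod.swap"

definition arrows :: "'a sep set \<Rightarrow> 'a osep set" where
  "arrows T = {r. underlying r \<in> T}"

definition sep_le :: "'a osep \<Rightarrow> 'a osep \<Rightarrow> bool"  (infix \<open>\<preceq>\<close> 50) where
  "r \<preceq> s \<longleftrightarrow> fst r \<subseteq> fst s \<and> snd r \<supseteq> snd s"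

definition sep_less :: "'a osep \<Rightarrow> 'a osep \<Rightarrow> bool"  (infix \<open>\<prec>\<close> 50) where
  "r \<prec> s \<longleftrightarrow> r \<preceq> s \<and> r \<noteq> s"

definition nested :: "'a sep set \<Rightarrow> bool" where
  "nested T \<longleftrightarrow> (\<forall>r\<in>T. \<forall>s\<in>T. \<exists>r' s'.
     underlying r' = r \<and> underlying s' = s \<and> (r' \<preceq> s' \<or> s' \<preceq> r'))"

definition degenerate :: "'a osep \<Rightarrow> bool" where
  "degenerate r \<longleftrightarrow> r = inv_sep r"

definition trivial_in :: "'a sep set \<Rightarrow> 'a osep \<Rightarrow> bool" where
  "trivial_in T r \<longleftrightarrow>
     (\<exists>s. underlying s \<in> T \<and> underlying s \<noteq> underlying r \<and> r \<prec> s \<and> r \<prec> inv_sep s)"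

definition small :: "'a osep \<Rightarrow> bool" where
  "small r \<longleftrightarrow> r \<preceq> inv_sep r"

definition tree_set :: "'a sep set \<Rightarrow> bool" where
  "tree_set T \<longleftrightarrow> nested T \<and> (\<forall>r\<in>arrows T. \<not> degenerate r \<and> \<not> trivial_in T r)"

definition regular_tree_set :: "'a sep set \<Rightarrow> bool" where
  "regular_tree_set T \<longleftrightarrow> tree_set T \<and> (\<forall>r\<in>arrows T. \<not> small r)"

definition orientation_of :: "'a osep set \<Rightarrow> 'a sep set \<Rightarrow> bool" where
  "orientation_of P T \<longleftrightarrow> P \<subseteq> arrows T \<and> (\<forall>s\<in>T. \<exists>!r. r \<in> P \<and> underlying r = s)"

definition partial_orientation_of :: "'a osep set \<Rightarrow> 'a sep set \<Rightarrow> bool" where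
  "partial_orientation_of P T \<longleftrightarrow> (\<exists>S\<subseteq>T. orientation_of P S)"

definition consistent :: "'a osep set \<Rightarrow> bool" where
  "consistent P \<longleftrightarrow>
     \<not> (\<exists>r s. underlying r \<noteq> underlying s \<and> r \<prec> s \<and> inv_sep r \<in> P \<and> s \<in> P)"

definition star :: "'a osep set \<Rightarrow> bool" where
  "star \<sigma> \<longleftrightarrow> (\<forall>r\<in>\<sigma>. \<forall>s\<in>\<sigma>. r \<noteq> s \<longrightarrow> r \<preceq> inv_sep s)"

definition maximal_elems :: "'a osep set \<Rightarrow> 'a osep set" where
  "maximal_elems P = {r \<in> P. \<not> (\<exists>s\<in>P. r \<prec> s)}"

definition down_closure :: "'a sep set \<Rightarrow> 'a osep set \<Rightarrow> 'a osep set" where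
  "down_closure T \<sigma> = {r \<in> arrows T. \<exists>s\<in>\<sigma>. r \<preceq> s}"

definition splitting_star :: "'a sep set \<Rightarrow> 'a osep set \<Rightarrow> bool" where
  "splitting_star T \<sigma> \<longleftrightarrow> star \<sigma> \<and> \<sigma> \<subseteq> arrows T \<and>
     (\<exists>P. orientation_of P T \<and> consistent P \<and> \<sigma> = maximal_elems P \<and> P = down_closure T \<sigma>)"


section \<open>Principal collections and admissible functions\<close>

text \<open>\<open>osep G X \<C>\<close> is the oriented separation \<open>(X, \<C>)\<close>, so \<open>inv_sep (osep G X \<C>)\<close> is
  \<open>(\<C>, X)\<close>; for a single component \<open>K\<close>, \<open>(X, K)\<close> is \<open>osep G X {K}\<close>.\<close>

definition osep :: "'a graph \<Rightarrow> 'a set \<Rightarrow> 'a set set \<Rightarrow> 'a osep" where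
  "osep G X \<C> = (verts G - \<Union>\<C>, X \<union> \<Union>\<C>)"

definition principal_collection :: "'a graph \<Rightarrow> 'a set set \<Rightarrow> bool" where
  "principal_collection G \<Y> \<longleftrightarrow> (\<forall>X\<in>\<Y>. X \<subseteq> verts G \<and>
     (\<forall>Y\<in>\<Y>. \<forall>C\<in>comps G Y. \<forall>D\<in>comps G Y. X \<inter> C \<noteq> {} \<longrightarrow> X \<inter> D \<noteq> {} \<longrightarrow> C = D))"

definition meets_unique_comp :: "'a graph \<Rightarrow> 'a set \<Rightarrow> 'a set \<Rightarrow> bool" where
  "meets_unique_comp G X Y \<longleftrightarrow> (\<exists>!C. C \<in> comps G X \<and> Y \<inter> C \<noteq> {})"

text \<open>This is \<open>C\<^sub>X(Y)\<close>; it is meaningful only if \<open>meets_unique_comp G X Y\<close>. In a principal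
  collection this holds whenever \<open>Y\<close> is not a subset of \<open>X\<close>, in particular for incomparable
  \<open>X\<close> and \<open>Y\<close> as in \<open>admissible\<close>.\<close>

definition comp_met :: "'a graph \<Rightarrow> 'a set \<Rightarrow> 'a set \<Rightarrow> 'a set" where
  "comp_met G X Y = (THE C. C \<in> comps G X \<and> Y \<inter> C \<noteq> {})"

definition admissible :: "'a graph \<Rightarrow> 'a set set \<Rightarrow> ('a set \<Rightarrow> 'a set set) \<Rightarrow> bool" where
  "admissible G \<Y> \<K> \<longleftrightarrow>
     (\<forall>X\<in>\<Y>. \<K> X \<subseteq> full_comps G X) \<and>
     (\<forall>X\<in>\<Y>. \<forall>Y\<in>\<Y>. \<not> X \<subseteq> Y \<longrightarrow> \<not> Y \<subseteq> X \<longrightarrow>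
        comp_met G X Y \<notin> \<K> X \<or> comp_met G Y X \<notin> \<K> Y)"

definition sep_set :: "'a graph \<Rightarrow> 'a set set \<Rightarrow> ('a set \<Rightarrow> 'a set set) \<Rightarrow> 'a sep set" where
  "sep_set G \<Y> \<K> = {underlying (osep G X (\<K> X)) | X. X \<in> \<Y>}
     \<union> {underlying (osep G X {K}) | X K. X \<in> \<Y> \<and> K \<in> \<K> X}"

definition sep_star :: "'a graph \<Rightarrow> ('a set \<Rightarrow> 'a set set) \<Rightarrow> 'a set \<Rightarrow> 'a osep set" where
  "sep_star G \<K> X = insert (osep G X (\<K> X)) {inv_sep (osep G X {K}) | K. K \<in> \<K> X}"


section \<open>Tangles and ends\<close>

definition finite_order_separations :: "'a graph \<Rightarrow> 'a sep set" where
  "finite_order_separations G = {{A, B} | A B. {A, B} \<in> separations G \<and> finite (A \<inter> B)}"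

text \<open>Intersecting with \<open>verts G\<close> matters only for the empty star, whose interior is \<open>verts G\<close>.\<close>

definition interior :: "'a graph \<Rightarrow> 'a osep set \<Rightarrow> 'a set" where
  "interior G \<sigma> = verts G \<inter> (\<Inter>(A, B)\<in>\<sigma>. B)"

definition aleph0_tangle :: "'a graph \<Rightarrow> 'a osep set \<Rightarrow> bool" where
  "aleph0_tangle G \<tau> \<longleftrightarrow>
     orientation_of \<tau> (finite_order_separations G) \<and> consistent \<tau> \<and>
     \<not> (\<exists>\<sigma>\<subseteq>\<tau>. finite \<sigma> \<and> star \<sigma> \<and> finite (interior G \<sigma>))"

definition tangle_filter :: "'a graph \<Rightarrow> 'a osep set \<Rightarrow> 'a set \<Rightarrow> 'a set set set" where
  "tangle_filter G \<tau> X = {\<C>. \<C> \<subseteq> comps G X \<and> osep G X \<C> \<in> \<tau>}"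

text \<open>For an \<open>\<aleph>\<^sub>0\<close>-tangle \<open>\<tau>\<close> and finite \<open>X\<close>, \<open>tangle_filter G \<tau> X\<close> is an ultrafilter
  on \<open>comps G X\<close>; it is free if its members have no element in common.\<close>

definition free_at :: "'a graph \<Rightarrow> 'a osep set \<Rightarrow> 'a set \<Rightarrow> bool" where
  "free_at G \<tau> X \<longleftrightarrow> X \<subseteq> verts G \<and> finite X \<and> \<Inter>(tangle_filter G \<tau> X) = {}"

definition ultrafilter_tangle :: "'a graph \<Rightarrow> 'a osep set \<Rightarrow> bool" where
  "ultrafilter_tangle G \<tau> \<longleftrightarrow> aleph0_tangle G \<tau> \<and> (\<exists>X. free_at G \<tau> X)"

text \<open>\<open>X\<^sub>\<tau>\<close>; the order used by \<open>LEAST\<close> on sets is inclusion.\<close>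

definition tangle_set :: "'a graph \<Rightarrow> 'a osep set \<Rightarrow> 'a set" where
  "tangle_set G \<tau> = (LEAST X. free_at G \<tau> X)"

definition ray :: "'a graph \<Rightarrow> (nat \<Rightarrow> 'a) \<Rightarrow> bool" where
  "ray G R \<longleftrightarrow> inj R \<and> range R \<subseteq> verts G \<and> (\<forall>n. adj G (R n) (R (Suc n)))"

definition tail_in :: "(nat \<Rightarrow> 'a) \<Rightarrow> 'a set \<Rightarrow> bool" where
  "tail_in R C \<longleftrightarrow> (\<exists>n. \<forall>m\<ge>n. R m \<in> C)"

definition ray_equiv :: "'a graph \<Rightarrow> ((nat \<Rightarrow> 'a) \<times> (nat \<Rightarrow> 'a)) set" where
  "ray_equiv G = {(R, S). ray G R \<and> ray G S \<and>
     (\<forall>X. X \<subseteq> verts G \<longrightarrow> finite X \<longrightarrow> (\<exists>C\<in>comps G X. tail_in R C \<and> tail_in S C))}"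

definition ends :: "'a graph \<Rightarrow> (nat \<Rightarrow> 'a) set set" where
  "ends G = {R. ray G R} // ray_equiv G"

definition end_comp :: "'a graph \<Rightarrow> 'a set \<Rightarrow> (nat \<Rightarrow> 'a) set \<Rightarrow> 'a set" where
  "end_comp G X \<omega> = (THE C. C \<in> comps G X \<and> (\<forall>R\<in>\<omega>. tail_in R C))"

definition end_tangle :: "'a graph \<Rightarrow> (nat \<Rightarrow> 'a) set \<Rightarrow> 'a osep set" where
  "end_tangle G \<omega> = {osep G X \<C> | X \<C>. X \<subseteq> verts G \<and> finite X \<and> \<C> \<subseteq> comps G X
     \<and> end_comp G X \<omega> \<in> \<C>}"

definition distinguishes :: "'a sep \<Rightarrow> 'a osep set \<Rightarrow> 'a osep set \<Rightarrow> bool" where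
  "distinguishes s \<tau>\<^sub>1 \<tau>\<^sub>2 \<longleftrightarrow> (\<exists>A B. s = {A, B} \<and> (A, B) \<in> \<tau>\<^sub>1 \<and> (B, A) \<in> \<tau>\<^sub>2)"

end

theory Submission
  imports Defs
begin

text \<open>
  Every component in \<open>\<K> X\<close> has all of \<open>X\<close> as its neighbourhood, so if it avoids \<open>Y\<close> it lies entirely in
  the component of \<open>G - Y\<close> that meets \<open>X\<close>. Hence for \<open>X \<noteq> Y\<close> there are \<open>r\<close> in the star of \<open>X\<close> and \<open>s\<close> in
  the star of \<open>Y\<close> with the inverse of \<open>r\<close> below \<open>s\<close>; nestedness, splitting stars and the distinguishing of
  tangles all come from this one link.

  For tangles, \<open>\<tau>\<close> is closed under suprema, so \<open>r \<in> \<tau>\<close> forces \<open>s \<in> \<tau>\<close> as soon as the right side of \<open>r\<close> meets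
  the left side of \<open>s\<close> in a finite set. If \<open>\<tau>\<close> is free at \<open>X\<close> and some \<open>r \<in> \<tau>\<close> has on its right side only
  finitely many vertices of components attached to \<open>x \<in> X\<close>, then \<open>\<tau>\<close> is still free at \<open>X - {x}\<close>. Applied at
  a free set of least size this gives the \<open>\<subseteq>\<close>-least one, and then that it is critical and that the components
  with full neighbourhood belong to the ultrafilter.
\<close>

section \<open>Order, inversion and underlying pairs of oriented separations\<close>

lemma sep_le_refl [simp]: "r \<preceq> r"
  by (simp add: sep_le_def)

lemma sep_le_trans [trans]: "r \<preceq> s \<Longrightarrow> s \<preceq> t \<Longrightarrow> r \<preceq> t"
  by (auto simp: sep_le_def)

lemma sep_le_antisym: "r \<preceq> s \<Longrightarrow> s \<preceq> r \<Longrightarrow> r = s"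
  by (auto simp: sep_le_def prod_eq_iff)

lemma inv_sep_inv_sep [simp]: "inv_sep (inv_sep r) = r"
  by (simp add: prod_eq_iff)

lemma inv_sep_le_iff: "inv_sep r \<preceq> s \<longleftrightarrow> inv_sep s \<preceq> r"
  by (auto simp: sep_le_def)

lemma le_inv_sep_iff: "r \<preceq> inv_sep s \<longleftrightarrow> s \<preceq> inv_sep r"
  by (auto simp: sep_le_def)

lemma inv_sep_le_inv_sep_iff: "inv_sep r \<preceq> inv_sep s \<longleftrightarrow> s \<preceq> r"
  by (auto simp: sep_le_def)

lemma underlying_eq_iff: "underlying r = underlying s \<longleftrightarrow> r = s \<or> r = inv_sep s"
  by (auto simp: underlying_def doubleton_eq_iff prod_eq_iff)

lemma underlying_inv_sep [simp]: "underlying (inv_sep r) = underlying r"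
  by (auto simp: underlying_def)

lemma arrows_inv_sep [simp]: "inv_sep r \<in> arrows T \<longleftrightarrow> r \<in> arrows T"
  by (simp add: arrows_def)

section \<open>Components\<close>

lemma adj_sym: "adj G u v \<longleftrightarrow> adj G v u"
  by (simp add: adj_def insert_commute)

lemma adj_del_verts: "adj (del_verts G X) u v \<longleftrightarrow> adj G u v \<and> u \<notin> X \<and> v \<notin> X"
  by (auto simp: adj_def del_verts_def)

lemma comps_alt:
  "comps G X = {{v \<in> verts G - X. (adj (del_verts G X))\<^sup>*\<^sup>* u v} | u. u \<in> verts G - X}"
  by (simp add: comps_def components_def del_verts_def)

lemma adj_rtranclp_sym: "(adj G)\<^sup>*\<^sup>* u v \<Longrightarrow> (adj G)\<^sup>*\<^sup>* v u"
  by (metis adj_sym sympI symp_rtranclp sympD)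

lemma comps_subset: "K \<in> comps G X \<Longrightarrow> K \<subseteq> verts G - X"
  by (auto simp: comps_alt)

lemma comps_nonempty: "K \<in> comps G X \<Longrightarrow> K \<noteq> {}"
  by (auto simp: comps_alt)

lemma comps_cover:
  assumes "v \<in> verts G" "v \<notin> X"
  obtains K where "K \<in> comps G X" "v \<in> K"
proof
  let ?K = "{w \<in> verts G - X. (adj (del_verts G X))\<^sup>*\<^sup>* v w}"
  show "?K \<in> comps G X" "v \<in> ?K" using assms unfolding comps_alt by blast+
qed

lemma comps_disjoint:
  assumes "K \<in> comps G X" "L \<in> comps G X" "v \<in> K" "v \<in> L"
  shows "K = L"
proof -
  have *: "K = {w \<in> verts G - X. (adj (del_verts G X))\<^sup>*\<^sup>* v w}"
    if "K \<in> comps G X" "v \<in> K" for K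
    using that by (auto simp: comps_alt dest: adj_rtranclp_sym intro: rtranclp_trans)
  show ?thesis using *[of K] *[of L] assms by simp
qed

lemma osep_simps [simp]:
  "fst (osep G X \<C>) = verts G - \<Union>\<C>" "snd (osep G X \<C>) = X \<union> \<Union>\<C>"
  by (simp_all add: osep_def)

locale sgraph =
  fixes G :: "'a graph"
  assumes simple: "simple_graph G"
begin

lemma adj_verts: "adj G u v \<Longrightarrow> v \<in> verts G"
  using simple by (fastforce simp: simple_graph_def adj_def doubleton_eq_iff)

text \<open>Connectedness of a component as an induction principle, so that later arguments exhibit
  a closed set \<open>S\<close> instead of handling walks.\<close>

lemma comps_connected:
  assumes "K \<in> comps G X" "S \<inter> K \<noteq> {}"
    and closed: "\<And>a b. a \<in> S \<Longrightarrow> a \<in> K \<Longrightarrow> b \<in> K \<Longrightarrow> adj G a b \<Longrightarrow> b \<in> S"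
  shows "K \<subseteq> S"
proof
  fix w assume w: "w \<in> K"
  obtain s where s: "s \<in> S" "s \<in> K" using assms(2) by auto
  obtain u where K: "K = {v \<in> verts G - X. (adj (del_verts G X))\<^sup>*\<^sup>* u v}"
    using assms(1) by (auto simp: comps_alt)
  have "(adj (del_verts G X))\<^sup>*\<^sup>* w s"
    using s w K by (auto dest: adj_rtranclp_sym intro: rtranclp_trans)
  \<comment> \<open>The induction follows a walk in \<open>G - X\<close> from \<open>s\<close> back
    to \<open>w\<close>. Membership in \<open>K\<close> stays a premise because it must be passed on
    from \<open>y\<close> to \<open>z\<close> before the induction hypothesis applies;
    \<open>closed\<close> is then used from \<open>z\<close> to \<open>y\<close>.\<close>
  then have "w \<in> K \<longrightarrow> w \<in> S"
  proof (induction rule: converse_rtranclp_induct)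
    case base
    then show ?case using s by simp
  next
    case (step y z)
    show ?case
    proof
      assume y: "y \<in> K"
      have "(adj (del_verts G X))\<^sup>*\<^sup>* u z" using y K step(1) by (auto intro: rtranclp.rtrancl_into_rtrancl)
      moreover have "z \<in> verts G - X"
        using step(1) adj_verts by (auto simp: adj_del_verts)
      ultimately have "z \<in> K" using K by auto
      with step y show "y \<in> S" by (metis closed adj_sym adj_del_verts)
    qed
  qed
  then show "w \<in> S" using w by simp
qed

lemma comps_closed:
  assumes "K \<in> comps G X" "u \<in> K" "adj G u v" "v \<notin> X"
  shows "v \<in> K"
proof -
  have "adj (del_verts G X) u v" using assms comps_subset by (fastforce simp: adj_del_verts)
  then show ?thesis using assms adj_verts
    by (auto simp: comps_alt intro: rtranclp.rtrancl_into_rtrancl)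
qed

lemma comps_subset_comps:
  assumes "K \<in> comps G X" "L \<in> comps G Y" "K \<inter> Y = {}" "L \<inter> K \<noteq> {}"
  shows "K \<subseteq> L"
  using assms(1,4) by (rule comps_connected) (use assms comps_closed in blast)

lemma nbhd_comps: "K \<in> comps G X \<Longrightarrow> nbhd G K \<subseteq> X"
  using comps_closed by (auto simp: nbhd_def)

text \<open>An edge between \<open>x\<close> and \<open>K\<close> puts a vertex of \<open>K\<close>
  into \<open>L\<close>, as \<open>K\<close> avoids \<open>Y\<close>; then
  \<open>comps_subset_comps\<close> applies.\<close>

lemma comps_subset_attached:
  assumes "K \<in> comps G X" "L \<in> comps G Y" "K \<inter> Y = {}" "x \<in> nbhd G K" "x \<in> L"
  shows "K \<subseteq> L"
proof -
  obtain k where "k \<in> K" "adj G k x" using assms(4) by (auto simp: nbhd_def)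
  then have "k \<in> L" using assms comps_closed[of L Y x k] adj_sym by (metis disjoint_iff)
  then show ?thesis using comps_subset_comps assms \<open>k \<in> K\<close> by (metis disjoint_iff)
qed

lemma osep_separation:
  assumes "X \<subseteq> verts G" "\<C> \<subseteq> comps G X"
  shows "underlying (osep G X \<C>) \<in> separations G"
proof -
  have "\<not> adj G a b" if "a \<notin> X" "a \<notin> \<Union>\<C>" "b \<in> \<Union>\<C>" for a b
    using that assms comps_closed adj_sym[of G a b] by blast
  then have "\<forall>a \<in> (verts G - \<Union>\<C>) - (X \<union> \<Union>\<C>). \<forall>b \<in> (X \<union> \<Union>\<C>) - (verts G - \<Union>\<C>). \<not> adj G a b"
    using assms(1) by blast
  moreover have "(verts G - \<Union>\<C>) \<union> (X \<union> \<Union>\<C>) = verts G" using assms comps_subset by blast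
  ultimately show ?thesis unfolding separations_def underlying_def osep_simps by blast
qed

lemma Union_comps_disjoint:
  "\<C> \<subseteq> comps G X \<Longrightarrow> X \<inter> \<Union>\<C> = {}"
  using comps_subset by fast

text \<open>The components partition \<open>verts G - X\<close>. This identity turns complements of
  sets of components into inversion of separations, both for tangles and for ends.\<close>

lemma osep_compl:
  assumes "X \<subseteq> verts G" "\<C> \<subseteq> comps G X"
  shows "osep G X (comps G X - \<C>) = inv_sep (osep G X \<C>)"
proof -
  have "\<Union>(comps G X - \<C>) = verts G - X - \<Union>\<C>"
  proof (intro equalityI subsetI)
    fix v assume "v \<in> \<Union>(comps G X - \<C>)"
    then obtain K where K: "K \<in> comps G X" "K \<notin> \<C>" "v \<in> K" by auto
    then have "v \<notin> L" if "L \<in> \<C>" for L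
      using comps_disjoint[of K G X L v] that assms(2) by auto
    then show "v \<in> verts G - X - \<Union>\<C>" using K comps_subset by blast
  next
    fix v assume v: "v \<in> verts G - X - \<Union>\<C>"
    then obtain K where "K \<in> comps G X" "v \<in> K" by (auto elim: comps_cover)
    then show "v \<in> \<Union>(comps G X - \<C>)" using v by auto
  qed
  moreover have "\<Union>\<C> \<subseteq> verts G - X" using assms(2) comps_subset by fast
  ultimately show ?thesis using assms(1) by (auto simp: prod_eq_iff)
qed

lemma comps_mem_iff:
  assumes "K \<in> comps G X" "\<C> \<subseteq> comps G X"
  shows "K \<in> \<C> \<longleftrightarrow> K \<inter> \<Union>\<C> \<noteq> {}"
proof
  assume "K \<inter> \<Union>\<C> \<noteq> {}"
  then obtain v L where "v \<in> K" "v \<in> L" "L \<in> \<C>" by blast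
  then show "K \<in> \<C>" using comps_disjoint assms by (metis subsetD)
qed (use assms comps_nonempty in blast)

section \<open>Stars at the members of a principal collection\<close>

lemma osep_antimono: "\<C> \<subseteq> \<D> \<Longrightarrow> osep G X \<D> \<preceq> osep G X \<C>"
  by (auto simp: sep_le_def)

lemma star_sep_star:
  assumes "X \<subseteq> verts G" "\<K> X \<subseteq> comps G X"
  shows "star (sep_star G \<K> X)"
proof -
  have "inv_sep (osep G X {K}) \<preceq> osep G X {L}" if "K \<in> \<K> X" "L \<in> \<K> X" "K \<noteq> L" for K L
  proof -
    have "K \<inter> L = {}" "K \<subseteq> verts G - X" "L \<subseteq> verts G - X"
      using that assms(2) comps_disjoint[of K G X L] comps_subset by blast+
    then show ?thesis using assms(1) by (auto simp: sep_le_def)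
  qed
  moreover have "osep G X (\<K> X) \<preceq> osep G X {K}" if "K \<in> \<K> X" for K
    using that by (intro osep_antimono) auto
  ultimately have "r \<preceq> inv_sep s" if "r \<in> sep_star G \<K> X" "s \<in> sep_star G \<K> X" "r \<noteq> s" for r s
    using that unfolding sep_star_def
    by (elim insertE CollectE exE conjE) (auto simp: inv_sep_le_inv_sep_iff)
  then show ?thesis by (simp add: star_def)
qed

lemma order_osep:
  assumes "X \<subseteq> verts G" "\<C> \<subseteq> comps G X"
  shows "fst (osep G X \<C>) \<inter> snd (osep G X \<C>) = X"
  using Union_comps_disjoint assms by auto

lemma not_small_osep:
  assumes "\<C> \<subset> comps G X"
  shows "\<not> small (osep G X \<C>)"
proof -
  obtain D where D: "D \<in> comps G X" "D \<notin> \<C>" using assms by auto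
  have "D \<inter> \<Union>\<C> = {}" using comps_mem_iff D assms by blast
  moreover obtain d where "d \<in> D" using comps_nonempty D by blast
  ultimately have "d \<in> verts G - \<Union>\<C>" "d \<notin> X \<union> \<Union>\<C>"
    using comps_subset D by blast+
  then show ?thesis by (auto simp: small_def sep_le_def)
qed

lemma not_small_inv_osep:
  assumes "\<C> \<subseteq> comps G X" "\<C> \<noteq> {}"
  shows "\<not> small (inv_sep (osep G X \<C>))"
proof -
  obtain D d where "D \<in> \<C>" "d \<in> D" using assms comps_nonempty by blast
  then show ?thesis by (auto simp: small_def sep_le_def)
qed

end

locale admissible_collection = sgraph +
  fixes \<Y> :: "'a set set" and \<K> :: "'a set \<Rightarrow> 'a set set"
  assumes principal: "principal_collection G \<Y>"
    and admissible: "admissible G \<Y> \<K>"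
begin

abbreviation "T \<equiv> sep_set G \<Y> \<K>"
abbreviation "\<sigma> \<equiv> sep_star G \<K>"

lemma subset_verts: "X \<in> \<Y> \<Longrightarrow> X \<subseteq> verts G"
  using principal by (auto simp: principal_collection_def)

lemma full: "X \<in> \<Y> \<Longrightarrow> \<K> X \<subseteq> full_comps G X"
  using admissible by (auto simp: admissible_def)

lemma subset_comps: "X \<in> \<Y> \<Longrightarrow> \<K> X \<subseteq> comps G X"
  using full by (auto simp: full_comps_def)

lemma nbhd_eq: "X \<in> \<Y> \<Longrightarrow> K \<in> \<K> X \<Longrightarrow> nbhd G K = X"
  using full by (auto simp: full_comps_def)

text \<open>A vertex of \<open>Y - X\<close> gives existence and principality gives uniqueness. All
  other components of \<open>G - X\<close> miss \<open>Y\<close>, which confines \<open>Y\<close> to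
  \<open>X\<close> and this one component.\<close>

lemma comp_met:
  assumes "X \<in> \<Y>" "Y \<in> \<Y>" "\<not> Y \<subseteq> X"
  shows "meets_unique_comp G X Y" "comp_met G X Y \<in> comps G X" "Y \<subseteq> X \<union> comp_met G X Y"
    "\<And>C. C \<in> comps G X \<Longrightarrow> Y \<inter> C \<noteq> {} \<Longrightarrow> C = comp_met G X Y"
proof -
  have uniq: "C = D" if "C \<in> comps G X" "D \<in> comps G X" "Y \<inter> C \<noteq> {}" "Y \<inter> D \<noteq> {}" for C D
    using principal assms that unfolding principal_collection_def by blast
  obtain y where y: "y \<in> Y" "y \<notin> X" using assms(3) by auto
  then obtain C where "C \<in> comps G X" "y \<in> C" using subset_verts[OF assms(2)] comps_cover
    by (metis subsetD)
  then have "C \<in> comps G X \<and> Y \<inter> C \<noteq> {}" using y by auto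
  then show *: "meets_unique_comp G X Y"
    unfolding meets_unique_comp_def using uniq by (intro ex1I[of _ C]) auto
  have met: "comp_met G X Y \<in> comps G X \<and> Y \<inter> comp_met G X Y \<noteq> {}"
    using theI'[OF *[unfolded meets_unique_comp_def]] by (simp add: comp_met_def)
  then show "comp_met G X Y \<in> comps G X" by simp
  show eq: "C = comp_met G X Y" if "C \<in> comps G X" "Y \<inter> C \<noteq> {}" for C
    using uniq that met by blast
  show "Y \<subseteq> X \<union> comp_met G X Y"
  proof
    fix z assume z: "z \<in> Y"
    show "z \<in> X \<union> comp_met G X Y"
    proof (cases "z \<in> X")
      case False
      then obtain D where "D \<in> comps G X" "z \<in> D" using z subset_verts[OF assms(2)] comps_cover
        by (metis subsetD)
      then show ?thesis using eq[of D] z by auto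
    qed simp
  qed
qed

text \<open>Every \<open>L\<close> in \<open>\<K> Y\<close> has neighbourhood \<open>Y\<close>,
  which meets \<open>comp_met G X Y\<close>; since \<open>L\<close> avoids \<open>X\<close>, it lies
  in that component. So the right side of \<open>osep G Y (\<K> Y)\<close> is contained in
  \<open>X \<union> comp_met G X Y\<close>. The cases differ in whether that component belongs to
  \<open>\<K> X\<close> or is disjoint from all its members.\<close>

lemma separated:
  assumes XY: "X \<in> \<Y>" "Y \<in> \<Y>" "\<not> Y \<subseteq> X" and avoid: "\<And>L. L \<in> \<K> Y \<Longrightarrow> L \<inter> X = {}"
  shows "if comp_met G X Y \<in> \<K> X then osep G X {comp_met G X Y} \<preceq> osep G Y (\<K> Y)
    else inv_sep (osep G X (\<K> X)) \<preceq> osep G Y (\<K> Y)"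
proof -
  let ?C = "comp_met G X Y"
  note C = comp_met[OF XY]
  have below: "\<Union>(\<K> Y) \<subseteq> ?C"
  proof
    fix v assume "v \<in> \<Union>(\<K> Y)"
    then obtain L where L: "L \<in> \<K> Y" "v \<in> L" by auto
    obtain y where "y \<in> Y" "y \<in> ?C" using C XY by blast
    moreover have "L \<in> comps G Y" "nbhd G L = Y" using L XY subset_comps nbhd_eq by auto
    ultimately have "L \<subseteq> ?C"
      using comps_subset_attached[of L Y ?C X y] C(2) avoid L(1) by simp
    then show "v \<in> ?C" using L by auto
  qed
  show ?thesis
  proof (cases "?C \<in> \<K> X")
    case True
    then show ?thesis using below C(3) by (auto simp: sep_le_def)
  next
    case False
    then have "?C \<inter> \<Union>(\<K> X) = {}" using comps_mem_iff C(2) subset_comps XY by blast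
    then have "(X \<union> ?C) \<inter> \<Union>(\<K> X) = {}" using Union_comps_disjoint subset_comps XY by blast
    moreover have "?C \<inter> X = {}" "?C \<subseteq> verts G" using C(2) comps_subset by blast+
    moreover have "\<Union>(\<K> X) \<subseteq> verts G" using subset_comps[OF XY(1)] comps_subset by blast
    \<comment> \<open>\<open>A\<close> and \<open>B\<close> stand for the unions of
      \<open>\<K> X\<close> and \<open>\<K> Y\<close>, and \<open>V\<close> for the vertex set; what
      remains is pure set algebra.\<close>
    moreover have *: "X \<union> A \<subseteq> V - B \<and> Y \<union> B \<subseteq> V - A"
      if "(X \<union> C) \<inter> A = {}" "C \<inter> X = {}" "C \<subseteq> V" "A \<subseteq> V" "X \<subseteq> V" "Y \<subseteq> V"
        "B \<subseteq> C" "Y \<subseteq> X \<union> C" for A B C V :: "'a set"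
      using that by blast
    ultimately have "X \<union> \<Union>(\<K> X) \<subseteq> verts G - \<Union>(\<K> Y) \<and> Y \<union> \<Union>(\<K> Y) \<subseteq> verts G - \<Union>(\<K> X)"
      using below C(3) subset_verts XY by (intro *[where C = ?C]) simp_all
    then show ?thesis using False by (simp add: sep_le_def)
  qed
qed

text \<open>This chooses the order of the pair for \<open>separated\<close>. If one set contains the
  other, the larger one serves as \<open>Y'\<close>: its components avoid it and hence its subset.
  For incomparable sets, a component in \<open>\<K> Y'\<close> meeting \<open>X'\<close> would be
  \<open>comp_met G Y' X'\<close>, and admissibility excludes this for one of the two
  orders.\<close>

lemma avoiding:
  assumes "X \<in> \<Y>" "Y \<in> \<Y>" "X \<noteq> Y"
  obtains X' Y' where "(X', Y') = (X, Y) \<or> (X', Y') = (Y, X)" "\<not> Y' \<subseteq> X'" "\<And>L. L \<in> \<K> Y' \<Longrightarrow> L \<inter> X' = {}"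
proof -
  have sub: "L \<inter> X = {}" if "X \<subseteq> Y" "L \<in> \<K> Y" "Y \<in> \<Y>" for X Y L
    using that subset_comps comps_subset by blast
  have incomp: "L \<inter> X = {}" if "L \<in> \<K> Y" "comp_met G Y X \<notin> \<K> Y" "\<not> X \<subseteq> Y" "X \<in> \<Y>" "Y \<in> \<Y>" for X Y L
    using that comp_met(4)[of Y X L] subset_comps by blast
  consider "X \<subset> Y" | "Y \<subset> X" | "\<not> X \<subseteq> Y" "\<not> Y \<subseteq> X" using assms(3) by blast
  then show thesis
  proof cases
    case 1
    then show ?thesis using that[of X Y] sub[of X Y] assms by blast
  next
    case 2
    then show ?thesis using that[of Y X] sub[of Y X] assms by blast
  next
    case 3
    then have "comp_met G X Y \<notin> \<K> X \<or> comp_met G Y X \<notin> \<K> Y"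
      using admissible assms by (simp add: admissible_def)
    then show ?thesis
    proof
      assume "comp_met G X Y \<notin> \<K> X"
      then show ?thesis using that[of Y X] incomp[of _ X Y] assms 3 by blast
    next
      assume "comp_met G Y X \<notin> \<K> Y"
      then show ?thesis using that[of X Y] incomp[of _ Y X] assms 3 by blast
    qed
  qed
qed

lemma separation_pair:
  assumes "X \<in> \<Y>" "Y \<in> \<Y>" "X \<noteq> Y"
  shows "\<exists>(X', Y') \<in> {(X, Y), (Y, X)}.
          inv_sep (osep G X' (\<K> X')) \<preceq> osep G Y' (\<K> Y')
        \<or> (meets_unique_comp G X' Y'
           \<and> osep G X' (\<K> X') \<preceq> osep G X' {comp_met G X' Y'}
           \<and> osep G X' {comp_met G X' Y'} \<preceq> osep G Y' (\<K> Y'))"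
proof -
  obtain X' Y' where *: "(X', Y') = (X, Y) \<or> (X', Y') = (Y, X)" "\<not> Y' \<subseteq> X'" "\<And>L. L \<in> \<K> Y' \<Longrightarrow> L \<inter> X' = {}"
    using avoiding[OF assms] by blast
  then have Y: "X' \<in> \<Y>" "Y' \<in> \<Y>" using assms by auto
  show ?thesis
    using * comp_met(1)[OF Y *(2)] separated[OF Y *(2,3)] osep_antimono[of "{comp_met G X' Y'}" "\<K> X'" X']
    by (intro bexI[of _ "(X', Y')"]) (auto split: if_splits)
qed

section \<open>Links between stars, nestedness and regularity\<close>

lemma osep_in_star: "osep G X (\<K> X) \<in> \<sigma> X"
  by (simp add: sep_star_def)

lemma inv_osep_in_star: "K \<in> \<K> X \<Longrightarrow> inv_sep (osep G X {K}) \<in> \<sigma> X"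
  unfolding sep_star_def by blast

text \<open>If the component \<open>C\<close> of \<open>G - X'\<close> met by \<open>Y'\<close> is
  in \<open>\<K> X'\<close>, the inverse of \<open>osep G X' {C}\<close> serves as the element of
  the star at \<open>X'\<close>, otherwise \<open>osep G X' (\<K> X')\<close>; at \<open>Y'\<close>
  it is always \<open>osep G Y' (\<K> Y')\<close>. Since inversion reverses the order, the
  conclusion is symmetric and passes from \<open>X'\<close>, \<open>Y'\<close> to \<open>X\<close>,
  \<open>Y\<close>.\<close>

lemma star_link:
  assumes "X \<in> \<Y>" "Y \<in> \<Y>" "X \<noteq> Y"
  obtains r s where "r \<in> \<sigma> X" "s \<in> \<sigma> Y" "inv_sep r \<preceq> s"
proof -
  obtain X' Y' where *: "(X', Y') = (X, Y) \<or> (X', Y') = (Y, X)" "\<not> Y' \<subseteq> X'" "\<And>L. L \<in> \<K> Y' \<Longrightarrow> L \<inter> X' = {}"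
    using avoiding[OF assms] by blast
  then have Y: "X' \<in> \<Y>" "Y' \<in> \<Y>" using assms by auto
  have "\<exists>r\<in>\<sigma> X'. \<exists>s\<in>\<sigma> Y'. inv_sep r \<preceq> s"
  proof (cases "comp_met G X' Y' \<in> \<K> X'")
    case True
    then have "osep G X' {comp_met G X' Y'} \<preceq> osep G Y' (\<K> Y')"
      using separated[OF Y *(2,3)] by auto
    then show ?thesis
      using osep_in_star inv_osep_in_star[OF True] by (metis inv_sep_inv_sep)
  next
    case False
    then show ?thesis using separated[OF Y *(2,3)] osep_in_star by auto
  qed
  then show thesis using *(1) that by (metis inv_sep_le_iff prod.inject)
qed

lemma sep_set_eq: "T = (\<Union>X\<in>\<Y>. underlying ` \<sigma> X)"
proof -
  have "underlying ` \<sigma> X = insert (underlying (osep G X (\<K> X))) ((\<lambda>K. underlying (osep G X {K})) ` \<K> X)" for X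
    by (simp add: sep_star_def Setcompr_eq_image image_image)
  then show ?thesis by (auto simp: sep_set_def)
qed

lemma star_subset_arrows: "X \<in> \<Y> \<Longrightarrow> \<sigma> X \<subseteq> arrows T"
  by (auto simp: sep_set_eq arrows_def)

lemma star_le: "X \<in> \<Y> \<Longrightarrow> r \<in> \<sigma> X \<Longrightarrow> s \<in> \<sigma> X \<Longrightarrow> r \<noteq> s \<Longrightarrow> r \<preceq> inv_sep s"
  using star_sep_star[of X \<K>] subset_verts subset_comps by (auto simp: star_def)

text \<open>Take the link \<open>inv_sep r \<preceq> s\<close>. For \<open>t = s\<close> it reads
  \<open>inv_sep t \<preceq> r\<close>; any other \<open>t\<close> satisfies
  \<open>t \<preceq> inv_sep s \<preceq> r\<close> by the star property.\<close>

lemma star_cross: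
  assumes "X \<in> \<Y>" "Y \<in> \<Y>" "X \<noteq> Y" "t \<in> \<sigma> Y"
  shows "\<exists>r\<in>\<sigma> X. t \<preceq> r \<or> inv_sep t \<preceq> r"
proof -
  obtain r s where rs: "r \<in> \<sigma> X" "s \<in> \<sigma> Y" "inv_sep r \<preceq> s" using star_link assms by blast
  then show ?thesis using star_le[OF assms(2,4) rs(2)] by (metis inv_sep_le_iff sep_le_trans)
qed

lemma nested_sep_set: "nested T"
proof -
  have "r \<preceq> s \<or> s \<preceq> r \<or> r \<preceq> inv_sep s \<or> inv_sep s \<preceq> r"
    if XY: "X \<in> \<Y>" "Y \<in> \<Y>" "r \<in> \<sigma> X" "s \<in> \<sigma> Y" for X Y r s
  proof (cases "X = Y")
    case True
    then show ?thesis using star_le[of X r s] that by (cases "r = s") auto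
  next
    case False
    \<comment> \<open>Some orientation of \<open>s\<close> lies below a member \<open>p\<close> of
      the star at \<open>X\<close>. If \<open>p\<close> differs from \<open>r\<close>, the star
      property \<open>p \<preceq> inv_sep r\<close> extends the chain to an orientation of
      \<open>r\<close>.\<close>
    then obtain p where p: "p \<in> \<sigma> X" "s \<preceq> p \<or> inv_sep s \<preceq> p"
      using star_cross[OF XY(1,2) _ XY(4)] False by blast
    show ?thesis
    proof (cases "p = r")
      case False
      then have "p \<preceq> inv_sep r" using star_le that p by blast
      then show ?thesis using p(2) by (metis inv_sep_le_iff le_inv_sep_iff sep_le_trans inv_sep_inv_sep)
    qed (use p in auto)
  qed
  then show ?thesis unfolding nested_def sep_set_eq
    by (smt (verit) UN_E imageE underlying_inv_sep)
qed

lemma down_closure_total: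
  assumes "X \<in> \<Y>" "t \<in> arrows T"
  shows "t \<in> down_closure T (\<sigma> X) \<or> inv_sep t \<in> down_closure T (\<sigma> X)"
proof -
  obtain Y s where s: "Y \<in> \<Y>" "s \<in> \<sigma> Y" "t = s \<or> t = inv_sep s"
    using assms(2) by (auto simp: arrows_def sep_set_eq underlying_eq_iff)
  have "\<exists>r\<in>\<sigma> X. s \<preceq> r \<or> inv_sep s \<preceq> r"
    using star_cross[OF assms(1) s(1) _ s(2)] s(2) sep_le_refl by (cases "X = Y") blast+
  then show ?thesis using s assms(2) by (auto simp: down_closure_def)
qed

text \<open>Degenerate and trivial orientations are small, so only smallness has to be excluded. A
  nonempty proper set of components leaves vertices strictly on both sides, and each
  \<open>{K}\<close> inherits properness from \<open>\<K> X\<close>.\<close>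

lemma regular_sep_set:
  assumes "\<And>X. X \<in> \<Y> \<Longrightarrow> {} \<subset> \<K> X \<and> \<K> X \<subset> comps G X"
  shows "regular_tree_set T"
proof -
  have *: "\<not> small r \<and> \<not> small (inv_sep r)" if "r \<in> \<sigma> X" "X \<in> \<Y>" for r X
  proof -
    have K: "{K} \<subset> comps G X" if "K \<in> \<K> X" for K
      using assms[OF \<open>X \<in> \<Y>\<close>] that by (intro subset_psubset_trans[of "{K}" "\<K> X"]) auto
    have "\<not> small (osep G X \<C>) \<and> \<not> small (inv_sep (osep G X \<C>))" if "\<C> \<subset> comps G X" "\<C> \<noteq> {}" for \<C>
      using that not_small_osep not_small_inv_osep by auto
    moreover have "r = osep G X (\<K> X) \<or> (\<exists>K\<in>\<K> X. r = inv_sep (osep G X {K}))"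
      using that(1) by (auto simp: sep_star_def)
    ultimately show ?thesis using K assms[OF that(2)] by (metis inv_sep_inv_sep insert_not_empty psubset_imp_subset less_le)
  qed
  have small: "\<not> small r" if r: "r \<in> arrows T" for r
  proof -
    obtain X s where "X \<in> \<Y>" "s \<in> \<sigma> X" "r = s \<or> r = inv_sep s"
      using r by (auto simp: arrows_def sep_set_eq underlying_eq_iff)
    then show ?thesis using * by blast
  qed
  have "small r" if "degenerate r" for r :: "'a osep"
    using that by (auto simp: degenerate_def small_def)
  moreover have "small r" if triv: "trivial_in T r" for r
  proof -
    obtain s where "r \<preceq> s" "r \<preceq> inv_sep s" using triv unfolding trivial_in_def sep_less_def by blast
    then show ?thesis unfolding small_def using le_inv_sep_iff sep_le_trans by blast
  qed
  ultimately show ?thesis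
    using small nested_sep_set unfolding regular_tree_set_def tree_set_def by blast
qed

section \<open>The consistent partial orientation by inverses, and splitting stars\<close>

lemma separator_eq:
  assumes "X \<in> \<Y>" "Y \<in> \<Y>" "underlying (osep G X (\<K> X)) = underlying (osep G Y (\<K> Y))"
  shows "X = Y"
proof -
  \<comment> \<open>The unordered pair determines its separator as the intersection of the two
    sides.\<close>
  have "\<Inter>(underlying (osep G X (\<K> X))) = X" if "X \<in> \<Y>" for X
    using order_osep[of X "\<K> X"] subset_verts subset_comps that by (simp add: underlying_def)
  then show ?thesis using assms by metis
qed

text \<open>By \<open>separator_eq\<close>, no separation receives two orientations. An
  inconsistency would give \<open>osep G X (\<K> X) \<preceq> inv_sep (osep G Y (\<K> Y))\<close>
  with \<open>X \<noteq> Y\<close>. This inequality is symmetric in the two sets, so the order from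
  \<open>avoiding\<close> may be used, and it contradicts both cases of
  \<open>separated\<close>.\<close>

lemma consistent_inverses:
  "let P = {inv_sep (osep G X (\<K> X)) | X. X \<in> \<Y> \<and> \<K> X \<subset> full_comps G X}
   in partial_orientation_of P T \<and> consistent P"
proof -
  define P where "P = {inv_sep (osep G X (\<K> X)) | X. X \<in> \<Y> \<and> \<K> X \<subset> full_comps G X}"
  have "r = s" if rs: "r \<in> P" "s \<in> P" "underlying r = underlying s" for r s
  proof -
    obtain X Y where "X \<in> \<Y>" "Y \<in> \<Y>" "r = inv_sep (osep G X (\<K> X))" "s = inv_sep (osep G Y (\<K> Y))"
      using rs(1,2) unfolding P_def by blast
    then show ?thesis using separator_eq[of X Y] rs(3) by (simp only: underlying_inv_sep)
  qed
  then have "orientation_of P (underlying ` P)"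
    unfolding orientation_of_def arrows_def by blast
  moreover have "underlying ` P \<subseteq> T" by (auto simp: P_def sep_set_def)
  ultimately have "partial_orientation_of P T" unfolding partial_orientation_of_def by blast
  moreover have "consistent P"
    unfolding consistent_def
  proof clarify
    fix r s assume neq: "underlying r \<noteq> underlying s" and "r \<prec> s" and "inv_sep r \<in> P" and "s \<in> P"
    then obtain X Y where X: "X \<in> \<Y>" "\<K> X \<subset> full_comps G X" "r = osep G X (\<K> X)"
      and Y: "Y \<in> \<Y>" "\<K> Y \<subset> full_comps G Y" "s = inv_sep (osep G Y (\<K> Y))"
      unfolding P_def mem_Collect_eq by (metis inv_sep_inv_sep)
    have le: "osep G X (\<K> X) \<preceq> inv_sep (osep G Y (\<K> Y))"
      using \<open>r \<prec> s\<close> X Y by (simp add: sep_less_def)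
    have "X \<noteq> Y" using neq X Y by auto
    then obtain X' Y' where *: "(X', Y') = (X, Y) \<or> (X', Y') = (Y, X)" "\<not> Y' \<subseteq> X'" "\<And>L. L \<in> \<K> Y' \<Longrightarrow> L \<inter> X' = {}"
      using avoiding[OF X(1) Y(1)] by blast
    have Y': "X' \<in> \<Y>" "Y' \<in> \<Y>" "\<K> X' \<subset> full_comps G X'" using *(1) X Y by auto
    have le': "osep G X' (\<K> X') \<preceq> inv_sep (osep G Y' (\<K> Y'))"
      using *(1) le by (auto simp: le_inv_sep_iff)
    show False
    proof (cases "comp_met G X' Y' \<in> \<K> X'")
      case True
      then have "osep G X' {comp_met G X' Y'} \<preceq> osep G Y' (\<K> Y')"
        using separated[OF Y'(1,2) *(2,3)] by auto
      \<comment> \<open>The two inequalities force every vertex outside \<open>X'\<close> into a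
        member of \<open>\<K> X'\<close>, but strictness of
        \<open>\<K> X' \<subset> full_comps G X'\<close> supplies a further component
        \<open>D\<close>.\<close>
      then have "verts G - \<Union>(\<K> X') \<subseteq> X' \<union> comp_met G X' Y'"
        using le' by (auto simp: sep_le_def)
      moreover obtain D where D: "D \<in> comps G X'" "D \<notin> \<K> X'"
        using Y'(3) by (auto simp: full_comps_def)
      moreover have "D \<inter> \<Union>(\<K> X') = {}" using D comps_mem_iff subset_comps[OF Y'(1)] by blast
      moreover have "D \<noteq> {}" "D \<subseteq> verts G - X'" using D comps_nonempty comps_subset by blast+
      ultimately show False using True by blast
    next
      case False
      then have "inv_sep (osep G X' (\<K> X')) \<preceq> osep G Y' (\<K> Y')"
        using separated[OF Y'(1,2) *(2,3)] by auto
      then have "osep G X' (\<K> X') = inv_sep (osep G Y' (\<K> Y'))"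
        using le' by (metis inv_sep_le_iff sep_le_antisym)
      then have "X' = Y'" using separator_eq Y' by (metis underlying_inv_sep)
      then show False using * by auto
    qed
  qed
  ultimately show ?thesis by (simp add: P_def)
qed

text \<open>The orientation is the down-closure of \<open>\<sigma> X\<close>, total by
  \<open>down_closure_total\<close>. The hypothesis \<open>inv_le\<close> prevents two distinct
  orientations of one separation and yields consistency; \<open>not_small\<close> makes the members
  of the star maximal. The exception in \<open>inv_le\<close> accommodates
  \<open>X = verts G\<close>, where the star is the single degenerate separation.\<close>

lemma splitting_star_if:
  assumes X: "X \<in> \<Y>"
    and inv_le: "\<And>s t. s \<in> \<sigma> X \<Longrightarrow> t \<in> \<sigma> X \<Longrightarrow> inv_sep s \<preceq> t \<Longrightarrow> s = t \<and> inv_sep s = s"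
    and not_small: "\<And>s t. s \<in> \<sigma> X \<Longrightarrow> t \<in> \<sigma> X \<Longrightarrow> s \<noteq> t \<Longrightarrow> \<not> small s"
  shows "splitting_star T (\<sigma> X)"
proof -
  define P where "P = down_closure T (\<sigma> X)"
  have sub: "\<sigma> X \<subseteq> P" using star_subset_arrows[OF X] sep_le_refl unfolding P_def down_closure_def by blast
  have both: "inv_sep r = r \<and> r \<in> \<sigma> X" if r: "r \<in> P" "inv_sep r \<in> P" for r
  proof -
    obtain s t where st: "s \<in> \<sigma> X" "t \<in> \<sigma> X" "r \<preceq> s" "inv_sep r \<preceq> t"
      using r by (auto simp: P_def down_closure_def)
    \<comment> \<open>The chain \<open>inv_sep s \<preceq> inv_sep r \<preceq> t\<close> makes
      \<open>s = t\<close> degenerate, which squeezes \<open>inv_sep r\<close> between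
      \<open>s\<close> and itself.\<close>
    then have "inv_sep s \<preceq> inv_sep r" by (metis inv_sep_le_iff inv_sep_inv_sep)
    then have "s = t \<and> inv_sep s = s" using inv_le st sep_le_trans by blast
    then have "inv_sep r = s" using st \<open>inv_sep s \<preceq> inv_sep r\<close> by (metis sep_le_antisym)
    then show ?thesis using \<open>s = t \<and> inv_sep s = s\<close> st by (metis inv_sep_inv_sep)
  qed
  have PT: "P \<subseteq> arrows T" by (auto simp: P_def down_closure_def)
  have "orientation_of P T"
    unfolding orientation_of_def
  proof (intro conjI ballI PT)
    fix u assume u: "u \<in> T"
    then obtain r where r: "underlying r = u" by (auto simp: sep_set_eq)
    then have "r \<in> P \<or> inv_sep r \<in> P" using down_closure_total[OF X] u by (simp add: P_def arrows_def)
    then show "\<exists>!r. r \<in> P \<and> underlying r = u"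
      using r both by (metis underlying_eq_iff inv_sep_inv_sep)
  qed
  moreover have "consistent P"
    unfolding consistent_def
  proof clarify
    fix r s assume rs: "underlying r \<noteq> underlying s" "r \<prec> s" "inv_sep r \<in> P" "s \<in> P"
    then obtain t where t: "t \<in> \<sigma> X" "s \<preceq> t" by (auto simp: P_def down_closure_def)
    have "r \<preceq> s" using rs by (simp add: sep_less_def)
    then have "r \<preceq> t" using t(2) by (rule sep_le_trans)
    \<comment> \<open>Both orientations of \<open>r\<close> now lie in \<open>P\<close>, so
      \<open>r\<close> is a degenerate member of the star and
      \<open>r \<preceq> s \<preceq> t = r\<close>.\<close>
    then have "r \<in> P" using rs t PT by (auto simp: P_def down_closure_def)
    then have r: "inv_sep r = r" "r \<in> \<sigma> X" using both rs by auto
    then have "r = t" using inv_le[of r t] t \<open>r \<preceq> t\<close> by simp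
    then have "r = s" using sep_le_antisym[OF \<open>r \<preceq> s\<close>] t(2) by simp
    then show False using rs(1) by simp
  qed
  moreover have "\<sigma> X = maximal_elems P"
  proof
    show "maximal_elems P \<subseteq> \<sigma> X"
      using sub by (fastforce simp: maximal_elems_def P_def down_closure_def sep_less_def)
    show "\<sigma> X \<subseteq> maximal_elems P"
    proof
      fix s assume s: "s \<in> \<sigma> X"
      have False if r: "r \<in> P" "s \<prec> r" for r
      proof -
        obtain t where t: "t \<in> \<sigma> X" "r \<preceq> t" using r by (auto simp: P_def down_closure_def)
        have "s \<preceq> r" using r by (simp add: sep_less_def)
        then have "s \<preceq> t" using t(2) by (rule sep_le_trans)
        have "s \<noteq> t" using sep_le_antisym[OF \<open>s \<preceq> r\<close>] r t by (auto simp: sep_less_def)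
        then have "t \<preceq> inv_sep s" using star_le X s t by blast
        with \<open>s \<preceq> t\<close> have "small s" unfolding small_def by (rule sep_le_trans)
        then show False using not_small s t \<open>s \<noteq> t\<close> by blast
      qed
      then show "s \<in> maximal_elems P" using s sub by (auto simp: maximal_elems_def)
    qed
  qed
  ultimately show ?thesis
    unfolding splitting_star_def
    using star_sep_star[of X \<K>, OF subset_verts[OF X] subset_comps[OF X]] star_subset_arrows[OF X] P_def
    by (intro conjI exI[of _ P])
qed

lemma splitting_star:
  assumes X: "X \<in> \<Y>" and "X = verts G \<or> (\<K> X \<subset> comps G X \<and> \<not> (\<exists>K. \<K> X \<subseteq> {K}))"
  shows "splitting_star T (\<sigma> X)"
proof (cases "X = verts G")
  case True
  then have "comps G X = {}" using comps_subset comps_nonempty by blast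
  then have "\<K> X = {}" using subset_comps X by auto
  then have "\<sigma> X = {osep G X {}}" by (auto simp: sep_star_def)
  then show ?thesis using True by (intro splitting_star_if X) (auto simp: osep_def)
next
  case False
  then have sub: "\<K> X \<subset> comps G X" and "\<not> (\<exists>K. \<K> X \<subseteq> {K})" using assms by auto
  then obtain K L where KL: "K \<in> \<K> X" "L \<in> \<K> X" "K \<noteq> L" by blast
  obtain D where D: "D \<in> comps G X" "D \<notin> \<K> X" using sub by auto
  have disj: "\<And>A B v. A \<in> comps G X \<Longrightarrow> B \<in> comps G X \<Longrightarrow> v \<in> A \<Longrightarrow> v \<in> B \<Longrightarrow> A = B"
    using comps_disjoint by metis
  obtain d where d: "d \<in> D" using D comps_nonempty by blast
  have d': "d \<in> verts G" "d \<notin> X" using d D comps_subset by blast+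
  have dK: "d \<notin> A" if "A \<in> \<K> X" for A using disj[of A D d] that sub D d by auto
  \<comment> \<open>A second member of \<open>\<K> X\<close> provides a vertex outside
    \<open>X \<union> A\<close>. Either this vertex or \<open>d\<close>, which avoids
    \<open>X\<close> and all members of \<open>\<K> X\<close>, refutes
    \<open>inv_sep s \<preceq> t\<close> in each of the four cases below.\<close>
  have other: "\<exists>b \<in> \<Union>(\<K> X). b \<notin> X \<union> A" if A: "A \<in> \<K> X" for A
  proof -
    obtain B where B: "B \<in> \<K> X" "B \<noteq> A" using KL by metis
    then obtain b where "b \<in> B" using comps_nonempty subset_comps[OF X] by blast
    then show ?thesis using B A disj[of A B b] comps_subset[of B G X] subset_comps[OF X] by blast
  qed
  have "\<not> inv_sep s \<preceq> t" if st: "s \<in> \<sigma> X" "t \<in> \<sigma> X" for s t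
  proof
    assume "inv_sep s \<preceq> t"
    then have le: "snd s \<subseteq> fst t" "snd t \<subseteq> fst s" by (simp_all add: sep_le_def)
    have cases: "s = osep G X (\<K> X) \<or> (\<exists>A\<in>\<K> X. s = inv_sep (osep G X {A}))" if "s \<in> \<sigma> X" for s
      using that by (auto simp: sep_star_def)
    have 1: "\<not> X \<union> \<Union>(\<K> X) \<subseteq> verts G - \<Union>(\<K> X)" using other[OF KL(1)] by blast
    have 2: "\<not> X \<union> \<Union>(\<K> X) \<subseteq> X \<union> A" if "A \<in> \<K> X" for A using other[OF that] by blast
    have 3: "\<not> verts G - A \<subseteq> X \<union> B" if "A \<in> \<K> X" "B \<in> \<K> X" for A B
      using d' dK that by blast
    from cases[OF st(1)] cases[OF st(2)] show False
    proof (elim disjE bexE)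
      assume "s = osep G X (\<K> X)" "t = osep G X (\<K> X)"
      with le 1 show False by simp
    next
      fix A assume "A \<in> \<K> X" "s = osep G X (\<K> X)" "t = inv_sep (osep G X {A})"
      with le(1) 2[of A] show False by simp
    next
      fix A assume "A \<in> \<K> X" "s = inv_sep (osep G X {A})" "t = osep G X (\<K> X)"
      with le(2) 2[of A] show False by simp
    next
      fix A B assume "A \<in> \<K> X" "B \<in> \<K> X" "s = inv_sep (osep G X {A})" "t = inv_sep (osep G X {B})"
      with le(1) 3[of A B] show False by simp
    qed
  qed
  moreover have "\<not> small s" if "s \<in> \<sigma> X" for s
    using that not_small_osep[OF sub] not_small_inv_osep[of _ X] subset_comps[OF X]
    by (auto simp: sep_star_def)
  ultimately show ?thesis by (intro splitting_star_if X) blast+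
qed

end

section \<open>The least free set of an ultrafilter tangle\<close>

locale tangle = sgraph +
  fixes \<tau> :: "'a osep set"
  assumes tangle: "aleph0_tangle G \<tau>"
begin

section \<open>Closure properties of tangles\<close>

abbreviation "FS \<equiv> arrows (finite_order_separations G)"

lemma FS_iff:
  "r \<in> FS \<longleftrightarrow> fst r \<union> snd r = verts G \<and>
     (\<forall>a \<in> fst r - snd r. \<forall>b \<in> snd r - fst r. \<not> adj G a b) \<and> finite (fst r \<inter> snd r)"
    (is "_ \<longleftrightarrow> ?sep (fst r) (snd r)")
proof
  assume "r \<in> FS"
  then obtain A B where AB: "{fst r, snd r} = {A, B}" "{A, B} \<in> separations G" "finite (A \<inter> B)"
    unfolding arrows_def finite_order_separations_def underlying_def mem_Collect_eq by metis
  then obtain C D where CD: "{A, B} = {C, D}" "C \<union> D = verts G" "\<forall>a \<in> C - D. \<forall>b \<in> D - C. \<not> adj G a b"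
    unfolding separations_def mem_Collect_eq by metis
  \<comment> \<open>The intersection of an unordered pair transfers finiteness of the separator
    without deciding which side is which.\<close>
  have "\<Inter>{fst r, snd r} = \<Inter>{C, D}" "\<Inter>{A, B} = \<Inter>{C, D}" using AB(1) CD(1) by simp_all
  then have fin: "finite (C \<inter> D)" using AB(3) by (simp add: Int_commute)
  have "{fst r, snd r} = {C, D}" using AB CD by simp
  then have "fst r = C \<and> snd r = D \<or> fst r = D \<and> snd r = C" by (simp add: doubleton_eq_iff)
  then show "?sep (fst r) (snd r)"
    using CD(2,3) fin adj_sym[of G] by (metis Int_commute Un_commute)
next
  assume "?sep (fst r) (snd r)"
  then have "{fst r, snd r} \<in> separations G" "finite (fst r \<inter> snd r)"
    unfolding separations_def by blast+
  then show "r \<in> FS" unfolding arrows_def finite_order_separations_def underlying_def by blast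
qed

text \<open>A vertex strictly on the left of the supremum is strictly on the left of
  \<open>r\<close> or of \<open>s\<close>; one strictly on the right is so for both. The new
  separator lies in the union of the old ones.\<close>

lemma FS_sup: "r \<in> FS \<Longrightarrow> s \<in> FS \<Longrightarrow> (fst r \<union> fst s, snd r \<inter> snd s) \<in> FS"
proof -
  assume "r \<in> FS" "s \<in> FS"
  then have r: "fst r \<union> snd r = verts G" "\<forall>a \<in> fst r - snd r. \<forall>b \<in> snd r - fst r. \<not> adj G a b" "finite (fst r \<inter> snd r)"
    and s: "fst s \<union> snd s = verts G" "\<forall>a \<in> fst s - snd s. \<forall>b \<in> snd s - fst s. \<not> adj G a b" "finite (fst s \<inter> snd s)"
    unfolding FS_iff by blast+
  have "\<not> adj G a b" if "a \<in> fst r \<union> fst s" "\<not> (a \<in> snd r \<and> a \<in> snd s)" "b \<in> snd r" "b \<in> snd s" "b \<notin> fst r" "b \<notin> fst s" for a b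
  proof -
    have "a \<in> verts G" using that(1) r(1) s(1) by blast
    then have "a \<in> fst r - snd r \<or> a \<in> fst s - snd s" using that(2) r(1) s(1) by blast
    then show ?thesis using r(2) s(2) that by blast
  qed
  moreover have "finite ((fst r \<union> fst s) \<inter> (snd r \<inter> snd s))"
    by (rule finite_subset[of _ "(fst r \<inter> snd r) \<union> (fst s \<inter> snd s)"]) (use r(3) s(3) in auto)
  moreover have "(fst r \<union> fst s) \<union> (snd r \<inter> snd s) = verts G" using r(1) s(1) by blast
  ultimately show ?thesis unfolding FS_iff by simp
qed

lemma osep_FS:
  assumes "X \<subseteq> verts G" "finite X" "\<C> \<subseteq> comps G X"
  shows "osep G X \<C> \<in> FS"
proof -
  have "{fst (osep G X \<C>), snd (osep G X \<C>)} \<in> separations G"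
    "finite (fst (osep G X \<C>) \<inter> snd (osep G X \<C>))"
    using osep_separation[OF assms(1,3)] order_osep[OF assms(1,3)] assms(2)
    unfolding underlying_def by simp_all
  then show ?thesis unfolding arrows_def finite_order_separations_def underlying_def by blast
qed

lemma oriented: "orientation_of \<tau> (finite_order_separations G)"
  and cons: "consistent \<tau>"
  and no_star: "\<sigma> \<subseteq> \<tau> \<Longrightarrow> finite \<sigma> \<Longrightarrow> star \<sigma> \<Longrightarrow> infinite (interior G \<sigma>)"
  using tangle unfolding aleph0_tangle_def by blast+

lemma in_FS: "r \<in> \<tau> \<Longrightarrow> r \<in> FS"
  using oriented by (auto simp: orientation_of_def)

lemma total: "r \<in> FS \<Longrightarrow> r \<in> \<tau> \<or> inv_sep r \<in> \<tau>"
  using oriented unfolding orientation_of_def arrows_def mem_Collect_eq by (metis underlying_eq_iff)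

lemma infinite_snd: "r \<in> \<tau> \<Longrightarrow> infinite (snd r)"
  using no_star[of "{r}"] by (auto simp: star_def interior_def case_prod_beta)

lemma not_inverse: "r \<in> \<tau> \<Longrightarrow> inv_sep r \<notin> \<tau>"
proof
  assume r: "r \<in> \<tau>" "inv_sep r \<in> \<tau>"
  then have "r = inv_sep r"
    using oriented unfolding orientation_of_def arrows_def by (metis underlying_inv_sep in_FS arrows_def mem_Collect_eq)
  then have "fst r = snd r" by (metis fst_swap)
  then show False using in_FS[OF r(1)] infinite_snd[OF r(1)] by (simp add: FS_iff)
qed

text \<open>Consistency concerns distinct underlying separations; in the remaining case
  \<open>s = inv_sep r\<close> the infinite right side of \<open>r\<close> would lie in its finite
  separator.\<close>

lemma down_closed:
  assumes "r \<in> \<tau>" "s \<in> FS" "s \<preceq> r"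
  shows "s \<in> \<tau>"
proof (rule ccontr)
  assume s: "s \<notin> \<tau>"
  then have "inv_sep s \<in> \<tau>" using total assms by blast
  moreover have "s \<prec> r" using s assms unfolding sep_less_def by blast
  ultimately have "underlying s = underlying r"
    using cons assms(1) unfolding consistent_def by blast
  then have "s = inv_sep r" using s assms(1) by (auto simp: underlying_eq_iff)
  then have "snd r \<subseteq> fst r \<inter> snd r" using assms(3) by (auto simp: sep_le_def)
  moreover have "finite (fst r \<inter> snd r)" using in_FS[OF assms(1)] by (simp add: FS_iff)
  ultimately show False using infinite_snd[OF assms(1)] finite_subset by blast
qed

text \<open>For \<open>r = (A, B)\<close> and \<open>s = (C, D)\<close>, failure puts
  \<open>(B \<inter> D, A \<union> C)\<close> into \<open>\<tau>\<close>, which also contains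
  \<open>(B \<inter> C, A \<union> D)\<close> since it lies below \<open>s\<close>. Together with
  \<open>r\<close> they form a star with interior inside the finite set
  \<open>(A \<inter> B) \<union> (C \<inter> D)\<close>.\<close>

lemma sup_closed:
  assumes r: "r \<in> \<tau>" and s: "s \<in> \<tau>"
  shows "(fst r \<union> fst s, snd r \<inter> snd s) \<in> \<tau>"
proof (rule ccontr)
  obtain A B where AB: "r = (A, B)" by force
  obtain C D where CD: "s = (C, D)" by force
  note FS = in_FS[OF r] in_FS[OF s]
  assume "\<not> ?thesis"
  then have 1: "(B \<inter> D, A \<union> C) \<in> \<tau>" using total[OF FS_sup[OF FS]] AB CD by simp
  have "(B, A) \<in> FS" using FS(1) AB by (simp add: arrows_def underlying_def insert_commute)
  then have "(D \<union> A, C \<inter> B) \<in> FS" "(C, D) \<in> FS"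
    using FS FS_sup[of "(C, D)" "(B, A)"] FS_sup[of "(D, C)" "(A, B)"] AB CD
    by (simp_all add: arrows_def underlying_def insert_commute)
  then have "(B \<inter> C, A \<union> D) \<in> FS" by (simp add: arrows_def underlying_def insert_commute Un_commute Int_commute)
  then have 2: "(B \<inter> C, A \<union> D) \<in> \<tau>" using down_closed[OF s] CD by (simp add: sep_le_def)
  have "star {(A, B), (B \<inter> C, A \<union> D), (B \<inter> D, A \<union> C)}"
    unfolding star_def sep_le_def by auto
  then have "infinite (interior G {(A, B), (B \<inter> C, A \<union> D), (B \<inter> D, A \<union> C)})"
    using 1 2 r AB by (intro no_star) auto
  moreover have "interior G {(A, B), (B \<inter> C, A \<union> D), (B \<inter> D, A \<union> C)} \<subseteq> (A \<inter> B) \<union> (C \<inter> D)"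
    by (auto simp: interior_def)
  ultimately show False using FS AB CD by (auto simp: FS_iff dest: finite_subset)
qed

text \<open>Otherwise the supremum of \<open>r\<close> and \<open>inv_sep s\<close> would be in
  \<open>\<tau>\<close> with finite right side \<open>snd r \<inter> fst s\<close>.\<close>

lemma mem_if_finite:
  assumes "r \<in> \<tau>" "s \<in> FS" "finite (snd r \<inter> fst s)"
  shows "s \<in> \<tau>"
proof (rule ccontr)
  assume "s \<notin> \<tau>"
  then have "inv_sep s \<in> \<tau>" using total assms by blast
  then show False using infinite_snd[OF sup_closed[OF assms(1), of "inv_sep s"]] assms(3) by simp
qed

section \<open>The ultrafilter on the components of \<open>G - X\<close>\<close>

lemma filter_compl:
  assumes "X \<subseteq> verts G" "finite X" "\<C> \<subseteq> comps G X"
  shows "comps G X - \<C> \<in> tangle_filter G \<tau> X \<longleftrightarrow> \<C> \<notin> tangle_filter G \<tau> X"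
  using total[OF osep_FS[OF assms]] not_inverse[of "osep G X \<C>"] assms(3)
  by (auto simp: tangle_filter_def osep_compl[OF assms(1,3)])

text \<open>As components are disjoint, the supremum of the two separations is the one given by the
  intersection, so \<open>sup_closed\<close> applies.\<close>

lemma filter_Int:
  assumes "\<C> \<in> tangle_filter G \<tau> X" "\<D> \<in> tangle_filter G \<tau> X"
  shows "\<C> \<inter> \<D> \<in> tangle_filter G \<tau> X"
proof -
  have sub: "\<C> \<subseteq> comps G X" "\<D> \<subseteq> comps G X" using assms by (auto simp: tangle_filter_def)
  have "\<Union>\<C> \<inter> \<Union>\<D> \<subseteq> \<Union>(\<C> \<inter> \<D>)"
  proof
    fix v assume "v \<in> \<Union>\<C> \<inter> \<Union>\<D>"
    then obtain K L where KL: "K \<in> \<C>" "L \<in> \<D>" "v \<in> K" "v \<in> L" by blast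
    then have "K = L" using comps_disjoint sub by (metis subsetD)
    then show "v \<in> \<Union>(\<C> \<inter> \<D>)" using KL by blast
  qed
  then have *: "\<Union>\<C> \<inter> \<Union>\<D> = \<Union>(\<C> \<inter> \<D>)" by blast
  have "(fst (osep G X \<C>) \<union> fst (osep G X \<D>), snd (osep G X \<C>) \<inter> snd (osep G X \<D>)) = osep G X (\<C> \<inter> \<D>)"
    unfolding osep_simps prod_eq_iff *[symmetric] by auto
  moreover have "osep G X \<C> \<in> \<tau>" "osep G X \<D> \<in> \<tau>" using assms by (simp_all add: tangle_filter_def)
  ultimately have "osep G X (\<C> \<inter> \<D>) \<in> \<tau>" using sup_closed by metis
  then show ?thesis using sub by (auto simp: tangle_filter_def)
qed

lemma empty_notin_filter: "finite X \<Longrightarrow> {} \<notin> tangle_filter G \<tau> X"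
  using infinite_snd[of "osep G X {}"] by (auto simp: tangle_filter_def)

lemma comps_in_filter:
  assumes "X \<subseteq> verts G" "finite X"
  shows "comps G X \<in> tangle_filter G \<tau> X"
  using filter_compl[OF assms, of "{}"] empty_notin_filter[OF assms(2)] by simp

text \<open>A member omitting \<open>K\<close> meets \<open>{K}\<close> in the empty set, which is
  never in the filter. Conversely, if \<open>{K}\<close> is not in the filter, its complement is and
  omits \<open>K\<close>.\<close>

lemma free_at_iff:
  "free_at G \<tau> X \<longleftrightarrow> X \<subseteq> verts G \<and> finite X \<and> (\<forall>K\<in>comps G X. {K} \<notin> tangle_filter G \<tau> X)"
proof (cases "X \<subseteq> verts G \<and> finite X")
  case True
  let ?U = "tangle_filter G \<tau> X"
  have sub: "\<C> \<subseteq> comps G X" if "\<C> \<in> ?U" for \<C> using that by (simp add: tangle_filter_def)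
  have "\<Inter>?U = {} \<longleftrightarrow> (\<forall>K\<in>comps G X. {K} \<notin> ?U)"
  proof
    assume empty: "\<Inter>?U = {}"
    show "\<forall>K\<in>comps G X. {K} \<notin> ?U"
    proof (intro ballI notI)
      fix K assume K: "K \<in> comps G X" "{K} \<in> ?U"
      obtain \<C> where \<C>: "\<C> \<in> ?U" "K \<notin> \<C>" using empty by blast
      then have "{} \<in> ?U" using filter_Int[OF K(2) \<C>(1)] by simp
      then show False using empty_notin_filter True by blast
    qed
  next
    assume *: "\<forall>K\<in>comps G X. {K} \<notin> ?U"
    have "K \<notin> \<Inter>?U" for K
    proof
      assume K: "K \<in> \<Inter>?U"
      then have "K \<in> comps G X" using comps_in_filter True by blast
      then have "comps G X - {K} \<in> ?U" using * filter_compl[of X "{K}"] True by simp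
      then show False using K by blast
    qed
    then show "\<Inter>?U = {}" by blast
  qed
  then show ?thesis using True by (simp add: free_at_def)
qed (auto simp: free_at_def)

lemma cofinite_in_filter:
  assumes "free_at G \<tau> X" "finite \<F>" "\<F> \<subseteq> comps G X"
  shows "comps G X - \<F> \<in> tangle_filter G \<tau> X"
  using assms(2,3)
proof induction
  case empty
  then show ?case using comps_in_filter assms(1) by (simp add: free_at_iff)
next
  case (insert K \<F>)
  then have "comps G X - {K} \<in> tangle_filter G \<tau> X"
    using assms(1) by (subst filter_compl) (auto simp: free_at_iff)
  moreover have "comps G X - \<F> \<in> tangle_filter G \<tau> X" using insert by blast
  moreover have "comps G X - insert K \<F> = (comps G X - {K}) \<inter> (comps G X - \<F>)" by blast
  ultimately show ?case using filter_Int by metis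
qed

section \<open>Removing vertices from a free set\<close>

lemma cofinite_osep:
  assumes "free_at G \<tau> X" "finite \<F>" "\<F> \<subseteq> comps G X"
  shows "inv_sep (osep G X \<F>) \<in> \<tau>"
  using cofinite_in_filter[OF assms] assms osep_compl[of X \<F>]
  by (simp add: tangle_filter_def free_at_iff)

text \<open>By \<open>mem_if_finite\<close> it suffices to find, for each component \<open>K\<close>
  of \<open>G - (X - {x})\<close>, an element of \<open>\<tau>\<close> whose right side meets
  \<open>K\<close> in a finite set. If \<open>x \<notin> K\<close>, then \<open>K\<close> is a
  component of \<open>G - X\<close> as well and freeness at \<open>X\<close> provides one. If
  \<open>x \<in> K\<close>, all other vertices of \<open>K\<close> lie in components of
  \<open>G - X\<close> attached to \<open>x\<close>, and \<open>r\<close> works.\<close>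

lemma free_at_remove:
  assumes free: "free_at G \<tau> X" and "x \<in> X" "r \<in> \<tau>"
    and fin: "finite (snd r \<inter> \<Union>{K \<in> comps G X. x \<in> nbhd G K})"
  shows "free_at G \<tau> (X - {x})"
proof -
  let ?Z = "X - {x}"
  have X: "X \<subseteq> verts G" "finite X" using free by (simp_all add: free_at_iff)
  then have Z: "?Z \<subseteq> verts G" "finite ?Z" by auto
  have "inv_sep (osep G ?Z {K}) \<in> \<tau>" if K: "K \<in> comps G ?Z" for K
  proof -
    have FS: "inv_sep (osep G ?Z {K}) \<in> FS" using osep_FS[OF Z, of "{K}"] K by simp
    have KZ: "K \<inter> ?Z = {}" "K \<subseteq> verts G" using K comps_subset by blast+
    show ?thesis
    proof (cases "x \<in> K")
      case False
      then have KX: "K \<inter> X = {}" using KZ by blast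
      obtain u where u: "u \<in> K" using K comps_nonempty by blast
      then have "u \<in> verts G" "u \<notin> X" using KX KZ by auto
      then obtain L where L: "L \<in> comps G X" "u \<in> L" by (rule comps_cover)
      have "L \<inter> ?Z = {}" using L comps_subset by blast
      then have "K = L"
        using comps_subset_comps[OF K L(1) KX] comps_subset_comps[OF L(1) K] u L by blast
      then have "inv_sep (osep G X {K}) \<in> \<tau>" using L cofinite_osep[OF free, of "{K}"] by simp
      moreover have "snd (inv_sep (osep G X {K})) \<inter> fst (inv_sep (osep G ?Z {K})) \<subseteq> X" by auto
      ultimately show ?thesis using mem_if_finite FS finite_subset X by blast
    next
      case True
      have "K \<subseteq> insert x (\<Union>{K \<in> comps G X. x \<in> nbhd G K})"
      proof
        fix k assume k: "k \<in> K"
        show "k \<in> insert x (\<Union>{K \<in> comps G X. x \<in> nbhd G K})"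
        proof (cases "k = x")
          case False
          then have "k \<in> verts G" "k \<notin> X" using k KZ by auto
          then obtain L where L: "L \<in> comps G X" "k \<in> L" by (rule comps_cover)
          have xL: "x \<notin> L" using L comps_subset \<open>x \<in> X\<close> by blast
          have "x \<in> nbhd G L"
          proof (rule ccontr)
            assume "x \<notin> nbhd G L"
            then have nadj: "\<not> adj G a x" if "a \<in> L" for a
              using that xL X \<open>x \<in> X\<close> by (auto simp: nbhd_def)
            \<comment> \<open>\<open>K\<close> meets \<open>X\<close> only in \<open>x\<close>, so
              without an edge to \<open>x\<close> no edge inside \<open>K\<close> leaves
              \<open>L\<close>.\<close>
            have "K \<subseteq> L"
            proof (rule comps_connected[OF K])
              show "L \<inter> K \<noteq> {}" using k L by blast
              fix a b assume ab: "a \<in> L" "b \<in> K" "adj G a b"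
              then have "b \<notin> X" using nadj KZ by blast
              then show "b \<in> L" using comps_closed L ab by blast
            qed
            then show False using True xL by blast
          qed
          then show ?thesis using L by blast
        qed simp
      qed
      then have "snd r \<inter> fst (inv_sep (osep G ?Z {K})) \<subseteq> X \<union> (snd r \<inter> \<Union>{K \<in> comps G X. x \<in> nbhd G K})"
        using \<open>x \<in> X\<close> by auto
      then show ?thesis using mem_if_finite[OF \<open>r \<in> \<tau>\<close> FS] fin X finite_subset by blast
    qed
  qed
  then have "{K} \<notin> tangle_filter G \<tau> ?Z" if "K \<in> comps G ?Z" for K
    using not_inverse[of "inv_sep (osep G ?Z {K})"] that by (simp add: tangle_filter_def)
  then show ?thesis using Z by (simp add: free_at_iff)
qed

text \<open>The candidate is a free set \<open>X\<close> of least cardinality. If some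
  \<open>x \<in> X\<close> were outside a free set \<open>Y\<close>, in a component \<open>L\<close>
  of \<open>G - Y\<close>, then each component of \<open>G - X\<close> attached to \<open>x\<close>
  would lie in \<open>L\<close> or be one of the finitely many meeting \<open>Y\<close>. Freeness at
  \<open>X\<close> and at \<open>Y\<close> puts these on the left of elements of
  \<open>\<tau>\<close>; their supremum lets \<open>free_at_remove\<close> produce the smaller free
  set \<open>X - {x}\<close>.\<close>

lemma tangle_set_least:
  assumes "\<exists>X. free_at G \<tau> X"
  shows "free_at G \<tau> (tangle_set G \<tau>)" "free_at G \<tau> Y \<Longrightarrow> tangle_set G \<tau> \<subseteq> Y"
proof -
  obtain X where X: "free_at G \<tau> X" and min: "\<And>Y. free_at G \<tau> Y \<Longrightarrow> card X \<le> card Y"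
    using ex_has_least_nat[of "free_at G \<tau>" _ card] assms by blast
  have fin: "X \<subseteq> verts G" "finite X" using X by (simp_all add: free_at_iff)
  have sub: "X \<subseteq> Y" if Y: "free_at G \<tau> Y" for Y
  proof
    fix x assume x: "x \<in> X"
    show "x \<in> Y"
    proof (rule ccontr)
      assume "x \<notin> Y"
      then obtain L where L: "L \<in> comps G Y" "x \<in> L" using fin x comps_cover by (metis subsetD)
      define \<F> where "\<F> = {K \<in> comps G X. K \<inter> Y \<noteq> {}}"
      \<comment> \<open>A vertex lies in at most one component, so the image of the finite set
        \<open>Y\<close> under \<open>pick\<close> covers \<open>\<F>\<close>.\<close>
      define pick where "pick y = (SOME K. K \<in> comps G X \<and> y \<in> K)" for y
      have "\<F> \<subseteq> pick ` Y"
      proof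
        fix K assume "K \<in> \<F>"
        then obtain y where y: "K \<in> comps G X" "y \<in> K" "y \<in> Y" by (auto simp: \<F>_def)
        then have "pick y \<in> comps G X \<and> y \<in> pick y" unfolding pick_def by (metis (mono_tags, lifting) someI)
        then have "pick y = K" using comps_disjoint y by metis
        then show "K \<in> pick ` Y" using y by blast
      qed
      then have "finite \<F>" using Y finite_surj by (auto simp: free_at_iff)
      then have 1: "inv_sep (osep G X \<F>) \<in> \<tau>" using cofinite_osep[OF X] by (simp add: \<F>_def)
      have 2: "inv_sep (osep G Y {L}) \<in> \<tau>" using cofinite_osep[OF Y, of "{L}"] L by simp
      have "K \<subseteq> \<Union>\<F> \<union> L" if K: "K \<in> comps G X" "x \<in> nbhd G K" for K
      proof (cases "K \<inter> Y = {}")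
        case True
        then show ?thesis using comps_subset_attached[OF K(1) L(1) _ K(2) L(2)] by blast
      qed (use K in \<open>auto simp: \<F>_def\<close>)
      then have "snd (inv_sep (osep G X \<F>)) \<inter> snd (inv_sep (osep G Y {L})) \<inter> \<Union>{K \<in> comps G X. x \<in> nbhd G K} = {}"
        by fastforce
      then have "free_at G \<tau> (X - {x})" using free_at_remove[OF X x sup_closed[OF 1 2]] by simp
      then show False using min[of "X - {x}"] card_Diff1_less[OF fin(2) x] by simp
    qed
  qed
  have "tangle_set G \<tau> = X" unfolding tangle_set_def using X sub by (rule Least_equality)
  then show "free_at G \<tau> (tangle_set G \<tau>)" "free_at G \<tau> Y \<Longrightarrow> tangle_set G \<tau> \<subseteq> Y" using X sub by auto
qed

text \<open>If the components attached to some \<open>x \<in> X\<close> were not in the ultrafilter,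
  their complement would be, and \<open>free_at_remove\<close> would contradict leastness.
  Intersecting these members over the finite set \<open>X\<close> leaves the components with full
  neighbourhood.\<close>

lemma full_comps_in_filter:
  assumes ex: "\<exists>X. free_at G \<tau> X"
  shows "full_comps G (tangle_set G \<tau>) \<in> tangle_filter G \<tau> (tangle_set G \<tau>)"
proof -
  define X where "X = tangle_set G \<tau>"
  let ?U = "tangle_filter G \<tau> X"
  have free: "free_at G \<tau> X" using tangle_set_least[OF ex] by (simp add: X_def)
  then have X: "X \<subseteq> verts G" "finite X" by (simp_all add: free_at_iff)
  have attached: "{K \<in> comps G X. x \<in> nbhd G K} \<in> ?U" if x: "x \<in> X" for x
  proof (rule ccontr)
    let ?A = "{K \<in> comps G X. x \<in> nbhd G K}"
    assume "?A \<notin> ?U"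
    then have "comps G X - ?A \<in> ?U" using filter_compl[OF X, of ?A] by auto
    then have r: "osep G X (comps G X - ?A) \<in> \<tau>" by (simp add: tangle_filter_def)
    have "?A \<subseteq> comps G X" by auto
    then have "snd (osep G X (comps G X - ?A)) = verts G - \<Union>?A"
      unfolding osep_compl[OF X(1) \<open>?A \<subseteq> comps G X\<close>] by simp
    then have "snd (osep G X (comps G X - ?A)) \<inter> \<Union>?A = {}" by blast
    then have "free_at G \<tau> (X - {x})" using free_at_remove[OF free x r] by simp
    then show False using tangle_set_least(2)[OF ex] x by (auto simp: X_def)
  qed
  have "{K \<in> comps G X. S \<subseteq> nbhd G K} \<in> ?U" if "finite S" "S \<subseteq> X" for S
    using that
  proof induction
    case empty
    then show ?case using comps_in_filter[OF X] by simp
  next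
    case (insert x S)
    have "{K \<in> comps G X. insert x S \<subseteq> nbhd G K}
        = {K \<in> comps G X. x \<in> nbhd G K} \<inter> {K \<in> comps G X. S \<subseteq> nbhd G K}" by blast
    then show ?case using filter_Int attached insert by simp
  qed
  from this[OF X(2) subset_refl] have "{K \<in> comps G X. X \<subseteq> nbhd G K} \<in> ?U" .
  moreover have "{K \<in> comps G X. X \<subseteq> nbhd G K} = full_comps G X"
    using nbhd_comps by (auto simp: full_comps_def)
  ultimately show ?thesis by (simp add: X_def)
qed

lemma tangle_set_crit:
  assumes "\<exists>X. free_at G \<tau> X"
  shows "tangle_set G \<tau> \<in> crit G"
proof -
  let ?X = "tangle_set G \<tau>"
  have free: "free_at G \<tau> ?X" using tangle_set_least[OF assms] by simp
  then have X: "?X \<subseteq> verts G" "finite ?X" by (simp_all add: free_at_iff)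
  have "infinite (full_comps G ?X)"
  proof
    assume "finite (full_comps G ?X)"
    then have "comps G ?X - full_comps G ?X \<in> tangle_filter G \<tau> ?X"
      using cofinite_in_filter[OF free] by (auto simp: full_comps_def)
    then show False
      using filter_compl[OF X, of "full_comps G ?X"] full_comps_in_filter[OF assms]
      by (auto simp: full_comps_def)
  qed
  then show ?thesis using X by (simp add: crit_def)
qed

end

section \<open>Distinguishing ends and tangles\<close>

context sgraph
begin

lemma ray_tail:
  assumes "ray G R" "finite X"
  obtains C where "C \<in> comps G X" "tail_in R C"
proof -
  have R: "inj R" "range R \<subseteq> verts G" "\<And>n. adj G (R n) (R (Suc n))"
    using assms(1) by (auto simp: ray_def)
  have "finite (R -` X)" using assms(2) R(1) by (rule finite_vimageI)
  then obtain n where "\<forall>m \<in> R -` X. m < n" using finite_nat_set_iff_bounded by blast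
  then have n: "R m \<notin> X" if "m \<ge> n" for m
    using that by (meson leD vimageI2)
  obtain C where C: "C \<in> comps G X" "R n \<in> C" using comps_cover[of "R n" G X] R(2) n[of n] by blast
  have "R m \<in> C" if "m \<ge> n" for m
    using that
  proof (induction m rule: dec_induct)
    case (step m)
    then show ?case using comps_closed[OF C(1) _ R(3)] n[of "Suc m"] by simp
  qed (rule C)
  then show thesis using that C(1) by (auto simp: tail_in_def)
qed

lemma tail_unique:
  assumes "C \<in> comps G X" "D \<in> comps G X" "tail_in R C" "tail_in R D"
  shows "C = D"
proof -
  obtain m n where "\<forall>k\<ge>m. R k \<in> C" "\<forall>k\<ge>n. R k \<in> D" using assms(3,4) unfolding tail_in_def by blast
  then have "R (max m n) \<in> C" "R (max m n) \<in> D" by simp_all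
  then show ?thesis using comps_disjoint assms by metis
qed

lemma end_comp_in_comps:
  assumes "\<omega> \<in> ends G" "X \<subseteq> verts G" "finite X"
  shows "end_comp G X \<omega> \<in> comps G X"
proof -
  obtain R where R: "ray G R" "\<omega> = ray_equiv G `` {R}"
    using assms(1) by (auto simp: ends_def quotient_def)
  obtain C where C: "C \<in> comps G X" "tail_in R C" using ray_tail R(1) assms(3) by blast
  \<comment> \<open>This is reflexivity of \<open>ray_equiv\<close> at \<open>R\<close>, hence the
    repeated conjunct. It places \<open>R\<close> in its own class, which gives uniqueness of the
    component.\<close>
  have "\<exists>D\<in>comps G Y. tail_in R D \<and> tail_in R D" if "finite Y" for Y
    using ray_tail[OF R(1) that] by blast
  then have "R \<in> \<omega>" using R by (simp add: ray_equiv_def)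
  have tails: "tail_in S C" if S: "S \<in> \<omega>" for S
  proof -
    obtain D where D: "D \<in> comps G X" "tail_in R D" "tail_in S D"
      using S R assms by (auto simp: ray_equiv_def)
    then show ?thesis using tail_unique[OF C(1) D(1) C(2) D(2)] by simp
  qed
  have "\<exists>!C. C \<in> comps G X \<and> (\<forall>R\<in>\<omega>. tail_in R C)"
    by (rule ex1I[of _ C]) (use C tails \<open>R \<in> \<omega>\<close> tail_unique in blast)+
  from theI'[OF this] show ?thesis by (simp add: end_comp_def)
qed

end

section \<open>Tangles containing one of the stars\<close>

locale tangle_collection = admissible_collection + tangle +
  assumes finite_member: "\<And>X. X \<in> \<Y> \<Longrightarrow> finite X"
begin

lemma arrows_subset_FS: "arrows T \<subseteq> FS"
proof
  fix t assume "t \<in> arrows T"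
  \<comment> \<open>Both kinds of members of \<open>T\<close> are treated at once:
    \<open>\<C>\<close> is \<open>\<K> X\<close> or a singleton \<open>{K}\<close>.\<close>
  then obtain X \<C> where "X \<in> \<Y>" "\<C> \<subseteq> \<K> X" and t: "underlying t = underlying (osep G X \<C>)"
    unfolding arrows_def sep_set_def by blast
  then have X: "X \<in> \<Y>" "\<C> \<subseteq> comps G X" using subset_comps by blast+
  then have "osep G X \<C> \<in> FS" by (intro osep_FS subset_verts finite_member)
  then show "t \<in> FS" using t by (simp add: arrows_def)
qed

lemma star_subset_tangle:
  assumes X: "X \<in> \<Y>" and free: "free_at G \<tau> X" and "\<K> X \<in> tangle_filter G \<tau> X"
  shows "\<sigma> X \<subseteq> \<tau>"
proof -
  have "inv_sep (osep G X {K}) \<in> \<tau>" if "K \<in> \<K> X" for K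
    using cofinite_osep[OF free, of "{K}"] subset_comps[OF X] that by auto
  then show ?thesis using assms(3) unfolding sep_star_def tangle_filter_def by blast
qed

text \<open>The down-closure lies in \<open>\<tau>\<close> by \<open>down_closed\<close>. An element
  of \<open>\<tau>\<close> missing from it would have its inverse there, against
  \<open>not_inverse\<close>.\<close>

lemma tangle_restrict:
  assumes X: "X \<in> \<Y>" and star: "\<sigma> X \<subseteq> \<tau>"
  shows "\<tau> \<inter> arrows T = down_closure T (\<sigma> X)"
proof -
  have sub: "down_closure T (\<sigma> X) \<subseteq> \<tau>"
    using star down_closed arrows_subset_FS unfolding down_closure_def by blast
  have "t \<in> down_closure T (\<sigma> X)" if "t \<in> \<tau>" "t \<in> arrows T" for t
    using down_closure_total[OF X that(2)] not_inverse[OF that(1)] sub by blast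
  then show ?thesis using sub unfolding down_closure_def by blast
qed

text \<open>At the least free set, \<open>\<K>\<close> picks the intersection of the full components
  with a cofinite set, and both belong to the ultrafilter.\<close>

lemma tangle_set_member:
  assumes "ultrafilter_tangle G \<tau>" "crit G \<subseteq> \<Y>" "\<And>X. X \<in> crit G \<Longrightarrow> finite (full_comps G X - \<K> X)"
  shows "tangle_set G \<tau> \<in> \<Y>" "\<sigma> (tangle_set G \<tau>) \<subseteq> \<tau>"
proof -
  let ?X = "tangle_set G \<tau>"
  have ex: "\<exists>X. free_at G \<tau> X" using assms(1) by (simp add: ultrafilter_tangle_def)
  have crit: "?X \<in> crit G" by (rule tangle_set_crit[OF ex])
  then show X: "?X \<in> \<Y>" using assms(2) by blast
  have free: "free_at G \<tau> ?X" by (rule tangle_set_least(1)[OF ex])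
  have "full_comps G ?X - \<K> ?X \<subseteq> comps G ?X" by (auto simp: full_comps_def)
  then have "comps G ?X - (full_comps G ?X - \<K> ?X) \<in> tangle_filter G \<tau> ?X"
    using cofinite_in_filter[OF free] assms(3) crit by blast
  moreover have "full_comps G ?X \<inter> (comps G ?X - (full_comps G ?X - \<K> ?X)) = \<K> ?X"
    using full[OF X] by (auto simp: full_comps_def)
  ultimately have "\<K> ?X \<in> tangle_filter G \<tau> ?X"
    using filter_Int[OF full_comps_in_filter[OF ex]] by metis
  then show "\<sigma> ?X \<subseteq> \<tau>" by (rule star_subset_tangle[OF X free])
qed

lemma distinguishes_end_tangle:
  assumes X: "X \<in> \<Y>" and star: "\<sigma> X \<subseteq> \<tau>" and \<omega>: "\<omega> \<in> ends G"
  shows "\<exists>s\<in>T. distinguishes s (end_tangle G \<omega>) \<tau> \<and> (\<exists>r \<in> \<sigma> X. underlying r = s)"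
proof -
  have fin: "X \<subseteq> verts G" "finite X" using X subset_verts finite_member by blast+
  have C: "end_comp G X \<omega> \<in> comps G X" by (rule end_comp_in_comps[OF \<omega> fin])
  have in_end: "osep G X \<C> \<in> end_tangle G \<omega>" if "\<C> \<subseteq> comps G X" "end_comp G X \<omega> \<in> \<C>" for \<C>
    using that fin unfolding end_tangle_def by blast
  \<comment> \<open>The component of the end is either some \<open>K\<close> in
    \<open>\<K> X\<close>, or it lies in the complement of \<open>\<K> X\<close>, whose separation
    is the inverse of \<open>osep G X (\<K> X)\<close>.\<close>
  have "\<exists>r\<in>\<sigma> X. inv_sep r \<in> end_tangle G \<omega>"
  proof (cases "end_comp G X \<omega> \<in> \<K> X")
    case True
    have "osep G X {end_comp G X \<omega>} \<in> end_tangle G \<omega>" using in_end C by simp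
    then show ?thesis using inv_osep_in_star[OF True] by (metis inv_sep_inv_sep)
  next
    case False
    then have "osep G X (comps G X - \<K> X) \<in> end_tangle G \<omega>" using in_end C by simp
    then show ?thesis using osep_compl[OF fin(1) subset_comps[OF X]] osep_in_star by metis
  qed
  then obtain r where r: "r \<in> \<sigma> X" "inv_sep r \<in> end_tangle G \<omega>" by blast
  have "distinguishes (underlying r) (end_tangle G \<omega>) \<tau>"
    unfolding distinguishes_def underlying_def
    using r star by (intro exI[of _ "snd r"] exI[of _ "fst r"]) (auto simp: insert_commute prod.swap_def)
  moreover have "underlying r \<in> T" using star_subset_arrows[OF X] r by (auto simp: arrows_def)
  ultimately show ?thesis using r by blast
qed

end

lemma distinguishes_commute: "distinguishes s \<tau> \<tau>' \<longleftrightarrow> distinguishes s \<tau>' \<tau>"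
  unfolding distinguishes_def by (metis insert_commute)

text \<open>The link supplies \<open>r \<in> \<sigma> X\<close>, hence in \<open>\<tau>\<close>,
  whose inverse is below an element of \<open>\<sigma> Y\<close> and so belongs to
  \<open>\<tau>'\<close> by \<open>tangle_restrict\<close>.\<close>

lemma (in admissible_collection) distinguishes_tangles:
  assumes tangle: "tangle G \<tau>" "tangle G \<tau>'" and fin: "\<And>X. X \<in> \<Y> \<Longrightarrow> finite X"
    and X: "X \<in> \<Y>" "\<sigma> X \<subseteq> \<tau>" and Y: "Y \<in> \<Y>" "\<sigma> Y \<subseteq> \<tau>'" and "X \<noteq> Y"
  shows "\<exists>s\<in>T. distinguishes s \<tau> \<tau>' \<and> (\<exists>r \<in> \<sigma> X. underlying r = s)"
proof -
  interpret \<tau>': tangle_collection G \<Y> \<K> \<tau>'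
    using tangle(2) fin unfolding tangle_collection_def tangle_collection_axioms_def
    by (simp add: admissible_collection_axioms)
  obtain r s where rs: "r \<in> \<sigma> X" "s \<in> \<sigma> Y" "inv_sep r \<preceq> s"
    using star_link X Y \<open>X \<noteq> Y\<close> by blast
  have r: "r \<in> arrows T" using star_subset_arrows X rs by blast
  then have "inv_sep r \<in> down_closure T (\<sigma> Y)" using rs unfolding down_closure_def by auto
  then have "inv_sep r \<in> \<tau>'" using \<tau>'.tangle_restrict[OF Y] by blast
  moreover have "r \<in> \<tau>" using rs X by blast
  ultimately have "distinguishes (underlying r) \<tau> \<tau>'"
    unfolding distinguishes_def underlying_def
    by (intro exI[of _ "fst r"] exI[of _ "snd r"]) (auto simp: prod.swap_def)
  then show ?thesis using r rs by (auto simp: arrows_def)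
qed

theorem theorem5p11:
  fixes G :: "'a graph"
    and \<Y> :: "'a set set"
    and \<K> :: "'a set \<Rightarrow> 'a set set"
    and T :: "'a sep set"
    and \<sigma> :: "'a set \<Rightarrow> 'a osep set"
  assumes "simple_graph G" and "connected_graph G"
    and "principal_collection G \<Y>"
    and "admissible G \<Y> \<K>"
  defines "T \<equiv> sep_set G \<Y> \<K>"
    and "\<sigma> \<equiv> sep_star G \<K>"
  shows
    "\<comment> \<open>(i)\<close>
     (\<forall>X\<in>\<Y>. \<forall>Y\<in>\<Y>. X \<noteq> Y \<longrightarrow>
       (\<exists>(X', Y') \<in> {(X, Y), (Y, X)}.
          inv_sep (osep G X' (\<K> X')) \<preceq> osep G Y' (\<K> Y')
        \<or> (meets_unique_comp G X' Y'
           \<and> osep G X' (\<K> X') \<preceq> osep G X' {comp_met G X' Y'}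
           \<and> osep G X' {comp_met G X' Y'} \<preceq> osep G Y' (\<K> Y'))))
   \<and> (let P = {inv_sep (osep G X (\<K> X)) | X. X \<in> \<Y> \<and> \<K> X \<subset> full_comps G X}
      in partial_orientation_of P T \<and> consistent P)
     \<comment> \<open>(ii)\<close>
   \<and> nested T
   \<and> ((\<forall>X\<in>\<Y>. {} \<subset> \<K> X \<and> \<K> X \<subset> comps G X) \<longrightarrow> regular_tree_set T)
     \<comment> \<open>(iii); for \<open>X \<noteq> verts G\<close>, if \<open>\<K> X\<close> has at most one element or equals \<open>comps G X\<close>,
         then \<open>\<sigma> X\<close> is never a splitting star\<close>
   \<and> (\<forall>X\<in>\<Y>. star (\<sigma> X) \<and>
       (X = verts G \<or> (\<K> X \<subset> comps G X \<and> \<not> (\<exists>K. \<K> X \<subseteq> {K}))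
          \<longrightarrow> splitting_star T (\<sigma> X)))
   \<and> ((\<forall>X\<in>\<Y>. finite X) \<longrightarrow>
       \<comment> \<open>(iv)\<close>
       (\<forall>\<tau>. ultrafilter_tangle G \<tau> \<and> tangle_set G \<tau> \<in> \<Y>
            \<and> \<K> (tangle_set G \<tau>) \<in> tangle_filter G \<tau> (tangle_set G \<tau>)
          \<longrightarrow> \<tau> \<inter> arrows T = down_closure T (\<sigma> (tangle_set G \<tau>)))
       \<comment> \<open>(v)\<close>
     \<and> (crit G \<subseteq> \<Y> \<and> (\<forall>X\<in>crit G. finite (full_comps G X - \<K> X)) \<longrightarrow>
         (\<forall>\<tau>\<^sub>1 \<tau>\<^sub>2. ultrafilter_tangle G \<tau>\<^sub>1 \<and> ultrafilter_tangle G \<tau>\<^sub>2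
              \<and> tangle_set G \<tau>\<^sub>1 \<noteq> tangle_set G \<tau>\<^sub>2 \<longrightarrow>
            (\<exists>s\<in>T. distinguishes s \<tau>\<^sub>1 \<tau>\<^sub>2 \<and> (\<exists>r \<in> \<sigma> (tangle_set G \<tau>\<^sub>1). underlying r = s)) \<and>
            (\<exists>s\<in>T. distinguishes s \<tau>\<^sub>1 \<tau>\<^sub>2 \<and> (\<exists>r \<in> \<sigma> (tangle_set G \<tau>\<^sub>2). underlying r = s))) \<and>
         (\<forall>\<omega>\<in>ends G. \<forall>\<tau>. ultrafilter_tangle G \<tau> \<longrightarrow>
            (\<exists>s\<in>T. distinguishes s (end_tangle G \<omega>) \<tau> \<and>
               (\<exists>r \<in> \<sigma> (tangle_set G \<tau>). underlying r = s)))))"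
proof -
  interpret admissible_collection G \<Y> \<K>
    using assms(1,3,4) by unfold_locales
  have coll: "tangle_collection G \<Y> \<K> \<tau>" if "ultrafilter_tangle G \<tau>" "\<forall>X\<in>\<Y>. finite X" for \<tau>
    using that unfolding ultrafilter_tangle_def by unfold_locales auto
  have iv: "\<tau> \<inter> arrows T = down_closure T (\<sigma> (tangle_set G \<tau>))"
    if fin: "\<forall>X\<in>\<Y>. finite X" and \<tau>: "ultrafilter_tangle G \<tau>" "tangle_set G \<tau> \<in> \<Y>"
      "\<K> (tangle_set G \<tau>) \<in> tangle_filter G \<tau> (tangle_set G \<tau>)" for \<tau>
  proof -
    interpret tangle_collection G \<Y> \<K> \<tau> by (rule coll[OF \<tau>(1) fin])
    have "free_at G \<tau> (tangle_set G \<tau>)"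
      using \<tau>(1) by (intro tangle_set_least) (simp add: ultrafilter_tangle_def)
    then show ?thesis unfolding T_def \<sigma>_def using tangle_restrict star_subset_tangle \<tau> by blast
  qed
  have member: "tangle_set G \<tau> \<in> \<Y>" "\<sigma> (tangle_set G \<tau>) \<subseteq> \<tau>"
    if fin: "\<forall>X\<in>\<Y>. finite X" and "crit G \<subseteq> \<Y> \<and> (\<forall>X\<in>crit G. finite (full_comps G X - \<K> X))"
      and \<tau>: "ultrafilter_tangle G \<tau>" for \<tau>
    using tangle_collection.tangle_set_member[OF coll[OF \<tau> fin] \<tau>] that(2) unfolding \<sigma>_def by blast+
  have v: "\<exists>s\<in>T. distinguishes s \<tau> \<tau>' \<and> (\<exists>r \<in> \<sigma> (tangle_set G \<tau>). underlying r = s)"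
    if fin: "\<forall>X\<in>\<Y>. finite X" and crit: "crit G \<subseteq> \<Y> \<and> (\<forall>X\<in>crit G. finite (full_comps G X - \<K> X))"
      and \<tau>: "ultrafilter_tangle G \<tau>" "ultrafilter_tangle G \<tau>'" "tangle_set G \<tau> \<noteq> tangle_set G \<tau>'" for \<tau> \<tau>'
  proof -
    have tangle: "tangle G \<tau>" "tangle G \<tau>'"
      using coll[OF \<tau>(1) fin] coll[OF \<tau>(2) fin] by (simp_all add: tangle_collection_def)
    show ?thesis
      using distinguishes_tangles[OF tangle _ member[OF fin crit \<tau>(1), unfolded \<sigma>_def]
          member[OF fin crit \<tau>(2), unfolded \<sigma>_def] \<tau>(3)] fin
      unfolding T_def \<sigma>_def by simp
  qed
  \<comment> \<open>A separation from the second star arises from \<open>v\<close> with the tangles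
    exchanged.\<close>
  have v_sym: "\<exists>s\<in>T. distinguishes s \<tau> \<tau>' \<and> (\<exists>r \<in> \<sigma> (tangle_set G \<tau>'). underlying r = s)"
    if "\<forall>X\<in>\<Y>. finite X" and "crit G \<subseteq> \<Y> \<and> (\<forall>X\<in>crit G. finite (full_comps G X - \<K> X))"
      and "ultrafilter_tangle G \<tau>" "ultrafilter_tangle G \<tau>'" "tangle_set G \<tau> \<noteq> tangle_set G \<tau>'" for \<tau> \<tau>'
    unfolding distinguishes_commute[of _ \<tau>] using v[of \<tau>' \<tau>] that by simp
  have v_end: "\<exists>s\<in>T. distinguishes s (end_tangle G \<omega>) \<tau> \<and> (\<exists>r \<in> \<sigma> (tangle_set G \<tau>). underlying r = s)"
    if fin: "\<forall>X\<in>\<Y>. finite X" and crit: "crit G \<subseteq> \<Y> \<and> (\<forall>X\<in>crit G. finite (full_comps G X - \<K> X))"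
      and \<tau>: "ultrafilter_tangle G \<tau>" and \<omega>: "\<omega> \<in> ends G" for \<tau> \<omega>
    unfolding T_def \<sigma>_def
    by (rule tangle_collection.distinguishes_end_tangle[OF coll[OF \<tau> fin] member[OF fin crit \<tau>, unfolded \<sigma>_def] \<omega>])
  show ?thesis
  proof (intro conjI)
    show "\<forall>X\<in>\<Y>. \<forall>Y\<in>\<Y>. X \<noteq> Y \<longrightarrow>
       (\<exists>(X', Y') \<in> {(X, Y), (Y, X)}.
          inv_sep (osep G X' (\<K> X')) \<preceq> osep G Y' (\<K> Y')
        \<or> (meets_unique_comp G X' Y'
           \<and> osep G X' (\<K> X') \<preceq> osep G X' {comp_met G X' Y'}
           \<and> osep G X' {comp_met G X' Y'} \<preceq> osep G Y' (\<K> Y')))"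
      using separation_pair by blast
    show "let P = {inv_sep (osep G X (\<K> X)) | X. X \<in> \<Y> \<and> \<K> X \<subset> full_comps G X}
      in partial_orientation_of P T \<and> consistent P"
      using consistent_inverses unfolding T_def .
    show "nested T" unfolding T_def by (rule nested_sep_set)
    show "(\<forall>X\<in>\<Y>. {} \<subset> \<K> X \<and> \<K> X \<subset> comps G X) \<longrightarrow> regular_tree_set T"
      unfolding T_def using regular_sep_set by blast
    show "\<forall>X\<in>\<Y>. star (\<sigma> X) \<and>
       (X = verts G \<or> (\<K> X \<subset> comps G X \<and> \<not> (\<exists>K. \<K> X \<subseteq> {K}))
          \<longrightarrow> splitting_star T (\<sigma> X))"
      unfolding T_def \<sigma>_def
      by (intro ballI conjI impI star_sep_star subset_verts subset_comps splitting_star)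
  qed (intro impI conjI allI ballI; (elim conjE)?; use iv v v_sym v_end in simp)
qed

end
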